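(* Let $W$ be a cocompact discrete reflection group of a CAT(0) space $X$, let $C$ be a chamber, and let $S$ be a minimal subset of the set $R$ of reflections in $W$ such that $C=\bigcap_{s\in S}X_s^+$. Then for each subset $T\subset S$: (1) $W_T\overline{C}$ is a convex subset of $X$ (hence a CAT(0) space); (2) the limit set $L(W_T)$ coincides with the boundary $\partial(W_T\overline{C})$; (3) the action of $W_T$ on $X$ is convex-cocompact.
   Context: An isometry $r$ of a geodesic space $X$ is a reflection if $r^2=\mathrm{id}$, the fixed-point set $F_r$ (the wall of $r$) has empty interior, $X\setminus F_r$ has exactly two convex connected components, and $r$ interchanges them. A reflection group is an isometry group generated by reflections. Let $W$ be a reflection group of $X$ acting properly (i.e. $\{\gamma\in W: \gamma x\in B(x,N)\}$ is finite for all $x\in X$, $N>0$), and $R$ the set of all reflections of $X$ lying in $W$. A chamber is a connected component $C$ of $X\setminus\bigcup_{r\in R}F_r$. $W$ is a cocompact discrete reflection group if $\overline{C}$ is compact and $\{\gamma\in W: \gamma C=C\}=\{1\}$. For $r\in R$, $X_r^+$ denotes the component of $X\setminus F_r$ containing $C$. $S\subset R$ is minimal with $C=\bigcap_{s\in S}X_s^+$; then $(W,S)$ is a Coxeter system. For $T\subset S$, $W_T$ is the subgroup generated by $T$. For a group $\Gamma$ acting properly by isometries on a CAT(0) space $X$, the limit set is $L(\Gamma)=\overline{\Gamma x_0}\cap\partial X$, where the closure is taken in $X\cup\partial X$ ($\partial X$ the visual boundary) and $x_0\in X$ (independent of $x_0$). $\Gamma$ is convex-cocompact if there is a compact $K\subset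 X$ with $\mathcal{R}_{x_0}(L(\Gamma))\subset\Gamma K$ for some $x_0\in X$, where $\mathcal{R}_{x_0}(L(\Gamma))$ is the union of the images of all geodesic rays $\xi$ from $x_0$ with $\xi(\infty)\in L(\Gamma)$. $\partial(W_T\overline{C})$ denotes the visual boundary of the convex set $W_T\overline{C}$, regarded as a subset of $\partial X$. *)

theory Defs
  imports "HOL-Analysis.Analysis"
begin

definition isometry :: "('a::metric_space \<Rightarrow> 'a) \<Rightarrow> bool" where
  "isometry f \<longleftrightarrow> surj f \<and> (\<forall>x y. dist (f x) (f y) = dist x y)"

definition geodesic_seg :: "(real \<Rightarrow> 'a::metric_space) \<Rightarrow> 'a \<Rightarrow> 'a \<Rightarrow> bool" where
  "geodesic_seg g x y \<longleftrightarrow> g 0 = x \<and> g (dist x y) = y \<and>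
     (\<forall>s\<in>{0..dist x y}. \<forall>t\<in>{0..dist x y}. dist (g s) (g t) = \<bar>s - t\<bar>)"

definition geodesic_space :: "'a::metric_space itself \<Rightarrow> bool" where
  "geodesic_space _ \<longleftrightarrow> (\<forall>x y::'a. \<exists>g. geodesic_seg g x y)"

text \<open>CAT(0): for every geodesic triangle, the distance between a point at distance t from x
  on a side [x,y] and a point at distance s from x on a side [x,z] is at most the distance of
  the corresponding points in the Euclidean comparison triangle (law of cosines).\<close>
definition CAT0 :: "'a::metric_space itself \<Rightarrow> bool" where
  "CAT0 T \<longleftrightarrow> geodesic_space T \<and>
    (\<forall>(x::'a) y z g1 g2. geodesic_seg g1 x y \<longrightarrow> geodesic_seg g2 x z \<longrightarrow>
      (\<forall>t\<in>{0..dist x y}. \<forall>s\<in>{0..dist x z}.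
         (dist (g1 t) (g2 s))\<^sup>2 \<le> t\<^sup>2 + s\<^sup>2
            - t * s * ((dist x y)\<^sup>2 + (dist x z)\<^sup>2 - (dist y z)\<^sup>2) / (dist x y * dist x z)))"

definition geo_convex :: "'a::metric_space set \<Rightarrow> bool" where
  "geo_convex Y \<longleftrightarrow> (\<forall>x\<in>Y. \<forall>y\<in>Y. \<forall>g. geodesic_seg g x y \<longrightarrow> g ` {0..dist x y} \<subseteq> Y)"

definition wall :: "('a \<Rightarrow> 'a) \<Rightarrow> 'a set" where
  "wall r = {x. r x = x}"

definition reflection :: "('a::metric_space \<Rightarrow> 'a) \<Rightarrow> bool" where
  "reflection r \<longleftrightarrow> isometry r \<and> r \<circ> r = id \<and> interior (wall r) = {} \<and>
     (\<exists>A B. A \<noteq> B \<and> components (- wall r) = {A, B} \<and> geo_convex A \<and> geo_convex B \<and>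
        r ` A = B \<and> r ` B = A)"

inductive_set gen_grp :: "('a \<Rightarrow> 'a) set \<Rightarrow> ('a \<Rightarrow> 'a) set" for G where
  gen_id: "id \<in> gen_grp G"
| gen_mul: "g \<in> G \<Longrightarrow> w \<in> gen_grp G \<Longrightarrow> g \<circ> w \<in> gen_grp G"
| gen_inv: "g \<in> G \<Longrightarrow> w \<in> gen_grp G \<Longrightarrow> inv g \<circ> w \<in> gen_grp G"

definition reflection_group :: "('a::metric_space \<Rightarrow> 'a) set \<Rightarrow> bool" where
  "reflection_group W \<longleftrightarrow> (\<exists>G. (\<forall>g\<in>G. reflection g) \<and> W = gen_grp G)"

definition acts_properly :: "('a::metric_space \<Rightarrow> 'a) set \<Rightarrow> bool" where
  "acts_properly W \<longleftrightarrow> (\<forall>x. \<forall>N>0. finite {g\<in>W. g x \<in> ball x N})"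

definition refls :: "('a::metric_space \<Rightarrow> 'a) set \<Rightarrow> ('a \<Rightarrow> 'a) set" where
  "refls W = {r\<in>W. reflection r}"

definition chamber :: "('a::metric_space \<Rightarrow> 'a) set \<Rightarrow> 'a set \<Rightarrow> bool" where
  "chamber W C \<longleftrightarrow> C \<in> components (- (\<Union>r\<in>refls W. wall r))"

definition cocompact_discrete_refl_group :: "('a::metric_space \<Rightarrow> 'a) set \<Rightarrow> bool" where
  "cocompact_discrete_refl_group W \<longleftrightarrow> reflection_group W \<and> acts_properly W \<and>
     (\<forall>C. chamber W C \<longrightarrow> compact (closure C) \<and> {g\<in>W. g ` C = C} = {id})"

definition half_space :: "('a::metric_space \<Rightarrow> 'a) \<Rightarrow> 'a set \<Rightarrow> 'a set" where
  "half_space r C = (THE A. A \<in> components (- wall r) \<and> C \<subseteq> A)"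

definition minimal_chamber_gens ::
  "('a::metric_space \<Rightarrow> 'a) set \<Rightarrow> 'a set \<Rightarrow> ('a \<Rightarrow> 'a) set \<Rightarrow> bool" where
  "minimal_chamber_gens W C S \<longleftrightarrow> S \<subseteq> refls W \<and> C = (\<Inter>s\<in>S. half_space s C) \<and>
     (\<forall>S'. S' \<subset> S \<longrightarrow> C \<noteq> (\<Inter>s\<in>S'. half_space s C))"

definition geodesic_ray :: "(real \<Rightarrow> 'a::metric_space) \<Rightarrow> bool" where
  "geodesic_ray c \<longleftrightarrow> (\<forall>s\<ge>0. \<forall>t\<ge>0. dist (c s) (c t) = \<bar>s - t\<bar>)"

definition asymptotic :: "(real \<Rightarrow> 'a::metric_space) \<Rightarrow> (real \<Rightarrow> 'a) \<Rightarrow> bool" where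
  "asymptotic c c' \<longleftrightarrow> (\<exists>B. \<forall>t\<ge>0. dist (c t) (c' t) \<le> B)"

definition vis_boundary :: "(real \<Rightarrow> 'a::metric_space) set set" where
  "vis_boundary = {{c'. geodesic_ray c' \<and> asymptotic c c'} | c. geodesic_ray c}"

text \<open>Limit set w.r.t. base point x0: boundary points xi in the cone-topology closure of the orbit,
  using the basic neighbourhoods U(c,r,eps) of xi (c the ray from x0 to xi).\<close>
definition limit_set :: "('a::metric_space \<Rightarrow> 'a) set \<Rightarrow> 'a \<Rightarrow> (real \<Rightarrow> 'a) set set" where
  "limit_set G x0 = {\<xi>\<in>vis_boundary. \<exists>c\<in>\<xi>. c 0 = x0 \<and>
     (\<forall>r>0. \<forall>\<epsilon>>0. \<exists>g\<in>G. dist x0 (g x0) > r \<and>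
        (\<exists>\<sigma>. geodesic_seg \<sigma> x0 (g x0) \<and> dist (\<sigma> r) (c r) < \<epsilon>))}"

definition boundary_of :: "'a::metric_space set \<Rightarrow> (real \<Rightarrow> 'a) set set" where
  "boundary_of Y = {\<xi>\<in>vis_boundary. \<exists>c\<in>\<xi>. \<forall>t\<ge>0. c t \<in> Y}"

definition ray_union :: "'a::metric_space \<Rightarrow> (real \<Rightarrow> 'a) set set \<Rightarrow> 'a set" where
  "ray_union x0 L = \<Union>{c ` {0..} | c. geodesic_ray c \<and> c 0 = x0 \<and> (\<exists>\<xi>\<in>L. c \<in> \<xi>)}"

definition convex_cocompact :: "('a::metric_space \<Rightarrow> 'a) set \<Rightarrow> bool" where
  "convex_cocompact G \<longleftrightarrow> (\<exists>K. compact K \<and>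
     (\<exists>x0. ray_union x0 (limit_set G x0) \<subseteq> (\<Union>g\<in>G. g ` K)))"

end

theory Submission
  imports Defs
begin

text \<open>Fix \<open>p \<in> C\<close>. Open half-spaces are convex, so a geodesic between two points of one of them avoids
  the wall; hence reflecting a point that a wall separates from \<open>p\<close> strictly shortens its distance
  to \<open>p\<close>. Minimising that distance over the orbit of a subgroup \<open>V\<close> moves any point into all closed
  half-spaces of reflections in \<open>V\<close>. Minimality of \<open>S\<close> shows that \<open>s \<in> S\<close> is the only reflection
  separating \<open>C\<close> from \<open>s C\<close>; hence the translates of \<open>C\<close> under \<open>W\<^sub>T\<close> are not separated from \<open>C\<close> by
  reflections outside \<open>W\<^sub>T\<close>. Together, the translates of the closure of \<open>C\<close> under \<open>W\<^sub>T\<close> fill exactly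
  the intersection of the closed half-spaces of reflections outside \<open>W\<^sub>T\<close>, which is closed and
  convex. The claims on limit sets follow by replacing rays with asymptotic ones from a prescribed
  base point; these exist because the space is complete, being covered by the translates under \<open>W\<close>
  of the compact closure of \<open>C\<close>.\<close>

section \<open>Geodesics in CAT(0) spaces\<close>

text \<open>The parameter runs over [0, 1] instead of arc length, so that points on two sides of a
  triangle can be compared at the same ratio. The choice of geodesic is harmless:
  \<open>geodesic_seg_eq_geo\<close> shows that it is unique in a CAT(0) space.\<close>

definition geo :: "'a::metric_space \<Rightarrow> 'a \<Rightarrow> real \<Rightarrow> 'a" where
  "geo x y a = (SOME g. geodesic_seg g x y) (a * dist x y)"

locale CAT0_space =
  fixes X :: "'a::metric_space itself"
  assumes cat0: "CAT0 TYPE('a)"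
begin

lemma geodesic_seg_geo:
  "\<exists>g. geodesic_seg g x y \<and> (\<forall>a. geo x y a = g (a * dist x (y::'a)))"
proof -
  have "\<exists>g. geodesic_seg g x y"
    using cat0 unfolding CAT0_def geodesic_space_def by blast
  then have "geodesic_seg (SOME g. geodesic_seg g x y) x y"
    by (rule someI_ex)
  then show ?thesis unfolding geo_def by blast
qed

lemma geo_0 [simp]: "geo x (y::'a) 0 = x"
  using geodesic_seg_geo[of x y] by (auto simp: geodesic_seg_def)

lemma geo_1 [simp]: "geo x (y::'a) 1 = y"
  using geodesic_seg_geo[of x y] by (auto simp: geodesic_seg_def)

lemma dist_geo_geo:
  assumes "a \<in> {0..1}" "b \<in> {0..1}"
  shows "dist (geo x y a) (geo x y b) = \<bar>a - b\<bar> * dist x (y::'a)"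
proof -
  obtain g where g: "geodesic_seg g x y" "\<And>a. geo x y a = g (a * dist x y)"
    using geodesic_seg_geo by blast
  have "a * dist x y \<in> {0..dist x y}" "b * dist x y \<in> {0..dist x y}"
    using assms by (auto simp: mult_left_le_one_le)
  then have "dist (g (a * dist x y)) (g (b * dist x y)) = \<bar>a * dist x y - b * dist x y\<bar>"
    using g(1) unfolding geodesic_seg_def by blast
  also have "\<dots> = \<bar>a - b\<bar> * dist x y"
    by (metis abs_mult abs_of_nonneg left_diff_distrib zero_le_dist)
  finally show ?thesis by (simp add: g(2))
qed

lemma dist_geo_start: "a \<in> {0..1} \<Longrightarrow> dist x (geo x y a) = a * dist x (y::'a)"
  using dist_geo_geo[of 0 a x y] by simp

lemma dist_geo_end: "a \<in> {0..1} \<Longrightarrow> dist (geo x y a) y = (1 - a) * dist x (y::'a)"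
  using dist_geo_geo[of a 1 x y] by simp

lemma CAT0_ineq:
  assumes "geodesic_seg g1 (x::'a) y" "geodesic_seg g2 x z" "t \<in> {0..dist x y}" "s \<in> {0..dist x z}"
  shows "(dist (g1 t) (g2 s))\<^sup>2 \<le> t\<^sup>2 + s\<^sup>2
            - t * s * ((dist x y)\<^sup>2 + (dist x z)\<^sup>2 - (dist y z)\<^sup>2) / (dist x y * dist x z)"
  using cat0 assms unfolding CAT0_def by blast

text \<open>Equality in the triangle inequality makes the comparison triangle of x, q, y degenerate.
  At distance \<open>dist x q\<close> from x on both sides starting in x, the CAT(0) bound is then
  0. Uniqueness of geodesics follows.\<close>

lemma geo_unique_dist:
  assumes q: "dist x q + dist q y = dist x (y::'a)"
  shows "q = geo x y (dist x q / dist x y)"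
proof (cases "dist x q = 0")
  case False
  then have pos: "dist x q > 0" "dist x y > 0"
    using q zero_le_dist[of q y] zero_le_dist[of x q] by linarith+
  obtain g1 where g1: "geodesic_seg g1 x q"
    using geodesic_seg_geo by blast
  obtain g2 where g2: "geodesic_seg g2 x y" "\<And>a. geo x y a = g2 (a * dist x y)"
    using geodesic_seg_geo by blast
  define t where "t = dist x q"
  define D where "D = dist x y"
  have "dist q y = D - t" using q by (simp add: t_def D_def)
  have "(dist (g1 t) (g2 t))\<^sup>2 \<le> t\<^sup>2 + t\<^sup>2 - t * t * (t\<^sup>2 + D\<^sup>2 - (D - t)\<^sup>2) / (t * D)"
    using CAT0_ineq[OF g1 g2(1), of t t] q \<open>dist q y = D - t\<close> zero_le_dist[of q y]
    by (simp add: t_def D_def)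
  also have "\<dots> = 0"
    using pos by (simp add: t_def[symmetric] D_def[symmetric] power2_eq_square field_simps)
  finally have "g1 t = g2 t" by simp
  moreover have "g1 t = q" using g1 by (simp add: geodesic_seg_def t_def)
  moreover have "g2 t = geo x y (dist x q / dist x y)"
    using pos g2(2) by (simp add: t_def)
  ultimately show ?thesis by simp
qed auto

lemma geodesic_seg_eq_geo:
  assumes g: "geodesic_seg g x (y::'a)" and t: "t \<in> {0..dist x y}"
  shows "g t = geo x y (t / dist x y)"
proof -
  have seg: "dist (g u) (g v) = \<bar>u - v\<bar>" if "u \<in> {0..dist x y}" "v \<in> {0..dist x y}" for u v
    using g that unfolding geodesic_seg_def by blast
  have "g 0 = x" "g (dist x y) = y" using g by (auto simp: geodesic_seg_def)
  then have "dist x (g t) = t" "dist (g t) y = dist x y - t"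
    using seg[of 0 t] seg[of t "dist x y"] t by auto
  then show ?thesis using geo_unique_dist[of x "g t" y] by simp
qed

lemma geo_convexD:
  assumes "geo_convex Y" "x \<in> Y" "(y::'a) \<in> Y" "a \<in> {0..1}"
  shows "geo x y a \<in> Y"
proof -
  obtain g where g: "geodesic_seg g x y" "\<And>a. geo x y a = g (a * dist x y)"
    using geodesic_seg_geo by blast
  have "a * dist x y \<in> {0..dist x y}"
    using assms(4) by (auto simp: mult_left_le_one_le)
  then show ?thesis
    using assms(1-3) g unfolding geo_convex_def by blast
qed

lemma geo_convexI:
  assumes "\<And>x y a. x \<in> Y \<Longrightarrow> y \<in> Y \<Longrightarrow> a \<in> {0..1} \<Longrightarrow> geo x (y::'a) a \<in> Y"
  shows "geo_convex Y"
  unfolding geo_convex_def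
proof (intro ballI allI impI subsetI)
  fix x y g z assume h: "x \<in> Y" "y \<in> Y" "geodesic_seg g x y" "z \<in> g ` {0..dist x y}"
  then obtain t where t: "t \<in> {0..dist x y}" "z = g t" by blast
  have "t / dist x y \<in> {0..1}" using t by (auto simp: divide_le_eq_1)
  then show "z \<in> Y" using geodesic_seg_eq_geo[OF h(3) t(1)] t(2) assms h by simp
qed

lemma geo_minus: "a \<in> {0..1} \<Longrightarrow> geo y x (1 - a) = geo x (y::'a) a"
proof -
  assume a: "a \<in> {0..1}"
  define q where "q = geo y x (1 - a)"
  have d: "dist y q = (1 - a) * dist x y" "dist q x = a * dist x y"
    using a dist_geo_start[of "1-a" y x] dist_geo_end[of "1-a" y x]
    by (auto simp: q_def dist_commute)
  then have "q = geo x y (dist x q / dist x y)"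
    by (intro geo_unique_dist) (simp add: dist_commute algebra_simps)
  \<comment> \<open>If x = y, the quotient in the previous fact is 0 / 0 = 0, so only the parameter
    0 is covered; on a constant geodesic all parameters agree.\<close>
  moreover have "x = y \<Longrightarrow> geo x y a = geo x y 0"
    using dist_geo_geo[of a 0 x y] a by simp
  ultimately show ?thesis using d unfolding q_def[symmetric]
    by (cases "x = y") (auto simp: dist_commute)
qed

lemma geo_geo:
  assumes "a \<in> {0..1}" "b \<in> {0..1}"
  shows "geo x (geo x y b) a = geo x (y::'a) (a * b)"
proof -
  define q where "q = geo x y (a * b)"
  have ab: "a * b \<in> {0..1}" using assms by (auto simp: mult_le_one)
  have d: "dist x q = a * b * dist x y" "dist x (geo x y b) = b * dist x y"
    using dist_geo_start[OF ab, of x y] dist_geo_start[OF assms(2), of x y] by (auto simp: q_def)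
  have "a * b \<le> b" using assms by (auto simp: mult_left_le_one_le)
  then have e: "dist q (geo x y b) = (b - a * b) * dist x y"
    using dist_geo_geo[OF ab assms(2), of x y] by (simp add: q_def)
  have "q = geo x (geo x y b) (dist x q / dist x (geo x y b))"
    by (rule geo_unique_dist) (use d e in \<open>simp add: algebra_simps\<close>)
  moreover have "x = z \<Longrightarrow> geo x z a = geo x z 0" for z
    using dist_geo_geo[of a 0 x z] assms by simp
  ultimately show ?thesis
    using d by (cases "b * dist x y = 0") (auto simp: q_def)
qed

text \<open>Shrinking both sides at x by the ratio a gives a similar comparison triangle, so the
  law-of-cosines bound collapses to the square of \<open>a * dist y z\<close>. Triangles with a side
  of length 0 at x are treated apart because that computation divides by both lengths.\<close>

lemma dist_geo_same_start:
  assumes a: "a \<in> {0..1}"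
  shows "dist (geo x y a) (geo x z a) \<le> a * dist y (z::'a)"
proof -
  obtain g1 where g1: "geodesic_seg g1 x y" "\<And>a. geo x y a = g1 (a * dist x y)"
    using geodesic_seg_geo by blast
  obtain g2 where g2: "geodesic_seg g2 x z" "\<And>a. geo x z a = g2 (a * dist x z)"
    using geodesic_seg_geo by blast
  consider "x = y" | "x = z" | "dist x y > 0" "dist x z > 0" by auto
  then show ?thesis
  proof cases
    case 1
    then show ?thesis using a dist_geo_geo[of a 0 x x] dist_geo_start[of a x z] by simp
  next
    case 2
    then show ?thesis using a dist_geo_geo[of a 0 x x] dist_geo_start[of a x y]
      by (simp add: dist_commute)
  next
    case 3
    define u v w where "u = dist x y" and "v = dist x z" and "w = dist y z"
    have "(dist (geo x y a) (geo x z a))\<^sup>2 \<le> (a * u)\<^sup>2 + (a * v)\<^sup>2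
            - (a * u) * (a * v) * (u\<^sup>2 + v\<^sup>2 - w\<^sup>2) / (u * v)"
      using CAT0_ineq[OF g1(1) g2(1), of "a * u" "a * v"] a
      by (auto simp: g1(2) g2(2) u_def v_def w_def mult_left_le_one_le)
    also have "\<dots> = (a * w)\<^sup>2"
      using 3 unfolding u_def[symmetric] v_def[symmetric]
      by (simp add: power2_eq_square field_simps)
    finally show ?thesis
      using a by (auto simp: w_def intro: power2_le_imp_le)
  qed
qed

text \<open>The diagonal from x to y' cuts the quadrilateral into two triangles, one with apex x and
  one with apex y'; the triangle estimate applies to each.\<close>

lemma dist_geo_convex:
  assumes a: "a \<in> {0..1}"
  shows "dist (geo x y a) (geo x' y' a) \<le> (1 - a) * dist x x' + a * dist y (y'::'a)"
proof -
  have "geo y' x (1 - a) = geo x y' a" "geo y' x' (1 - a) = geo x' y' a"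
    using geo_minus a by blast+
  moreover have "dist (geo y' x (1 - a)) (geo y' x' (1 - a)) \<le> (1 - a) * dist x x'"
    using dist_geo_same_start a by simp
  ultimately have "dist (geo x y' a) (geo x' y' a) \<le> (1 - a) * dist x x'"
    by simp
  then show ?thesis
    using dist_geo_same_start[OF a, of x y y']
      dist_triangle[of "geo x y a" "geo x' y' a" "geo x y' a"] by linarith
qed

lemma continuous_on_geo: "continuous_on {0..1} (geo x (y::'a))"
proof (rule continuous_on_subset, rule lipschitz_on_continuous_on)
  show "(dist x y)-lipschitz_on {0..1} (geo x y)"
    by (rule lipschitz_onI) (auto simp: dist_geo_geo dist_real_def mult.commute)
qed simp

lemma connected_starlike:
  assumes q: "(q::'a) \<in> A" and st: "\<And>y a. y \<in> A \<Longrightarrow> a \<in> {0..1} \<Longrightarrow> geo q y a \<in> A"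
  shows "connected A"
proof -
  have "A = (\<Union>y\<in>A. geo q y ` {0..1})"
  proof (intro equalityI subsetI)
    fix y assume "y \<in> A"
    moreover have "y = geo q y 1" by simp
    ultimately show "y \<in> (\<Union>y\<in>A. geo q y ` {0..1})"
      by (metis (no_types, lifting) UN_iff atLeastAtMost_iff image_eqI order.refl zero_le_one)
  qed (use st in blast)
  moreover have "connected (\<Union>y\<in>A. geo q y ` {0..1})"
  proof (rule connected_Union)
    have "q \<in> geo q y ` {0..1}" for y
      by (rule image_eqI[where x = 0]) auto
    then show "\<Inter> ((\<lambda>y. geo q y ` {0..1}) ` A) \<noteq> {}" by blast
  qed (auto intro!: connected_continuous_image continuous_on_geo)
  ultimately show ?thesis by simp
qed

lemma connected_geo_convex:
  assumes "geo_convex (A::'a set)"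
  shows "connected A"
proof (cases "A = {}")
  case False
  then obtain q where "q \<in> A" by blast
  then show ?thesis
    by (rule connected_starlike) (use assms \<open>q \<in> A\<close> geo_convexD in blast)
qed simp

text \<open>This is the local connectedness of the space: a small ball that avoids a closed wall
  lies in a single component of the complement.\<close>

lemma connected_ball_CAT0: "connected (ball (q::'a) e)"
proof (cases "e > 0")
  case True
  show ?thesis
  proof (rule connected_starlike)
    fix y a assume "y \<in> ball q e" "a \<in> {0..1::real}"
    then show "geo q y a \<in> ball q e"
      using dist_geo_start[of a q y] by (auto intro: le_less_trans[OF mult_left_le_one_le])
  qed (use True in simp)
qed (simp add: not_less ball_empty)

lemma geo_ray:
  assumes "geodesic_ray c" "0 \<le> t" "t \<le> u"
  shows "geo (c 0) (c u) (t / u) = (c t::'a)"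
proof -
  have "dist (c 0) (c t) = t" "dist (c t) (c u) = u - t" "dist (c 0) (c u) = u"
    using assms by (auto simp: geodesic_ray_def)
  then show ?thesis using geo_unique_dist[of "c 0" "c t" "c u"] by simp
qed

end

section \<open>Reflections and half-spaces\<close>

lemma isometry_dist: "isometry f \<Longrightarrow> dist (f x) (f y) = dist x y"
  by (simp add: isometry_def)

lemma isometry_bij: "isometry f \<Longrightarrow> bij f"
  unfolding isometry_def bij_def inj_def by (metis dist_eq_0_iff)

lemma isometry_inv_f [simp]: "isometry f \<Longrightarrow> inv f (f x) = x"
  by (simp add: bij_is_inj isometry_bij)

lemma isometry_f_inv [simp]: "isometry f \<Longrightarrow> f (inv f x) = x"
  by (simp add: isometry_def surj_f_inv_f)

lemma isometry_id: "isometry id"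
  by (simp add: isometry_def)

lemma isometry_comp: "isometry f \<Longrightarrow> isometry g \<Longrightarrow> isometry (f \<circ> g)"
  unfolding isometry_def using comp_surj by auto

lemma isometry_inv: "isometry f \<Longrightarrow> isometry (inv f)"
  using isometry_bij[of f] isometry_dist[of f "inv f x" "inv f y" for x y]
  by (auto simp: isometry_def bij_imp_bij_inv bij_is_surj surj_f_inv_f)

lemma continuous_on_isometry: "isometry f \<Longrightarrow> continuous_on A f"
  by (auto simp: continuous_on_iff isometry_dist)

lemma homeomorphism_isometry: "isometry f \<Longrightarrow> homeomorphism A (f ` A) f (inv f)"
  by (auto simp: homeomorphism_def continuous_on_isometry isometry_inv image_image)

lemma components_isometry_image:
  assumes "isometry f"
  shows "components (f ` U) = (`) f ` components U"
proof -
  have "connected_component_set (f ` U) (f x) = f ` connected_component_set U x" if "x \<in> U" for x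
    using connected_component_set_homeomorphism[OF homeomorphism_isometry[OF assms] that] .
  then show ?thesis by (simp add: components_def image_image cong: image_cong)
qed

lemma geo_convex_isometry_image:
  assumes f: "isometry f" and A: "geo_convex A"
  shows "geo_convex (f ` A)"
  unfolding geo_convex_def
proof (intro ballI allI impI)
  fix x y g assume xy: "x \<in> f ` A" "y \<in> f ` A" and g: "geodesic_seg g x y"
  obtain x' y' where x': "x' \<in> A" "x = f x'" and y': "y' \<in> A" "y = f y'" using xy by blast
  have "geodesic_seg (inv f \<circ> g) x' y'"
    using g isometry_dist[OF isometry_inv[OF f]] isometry_dist[OF f] f
    by (auto simp: geodesic_seg_def x' y')
  then have "(inv f \<circ> g) ` {0..dist x' y'} \<subseteq> A"
    using A x' y' unfolding geo_convex_def by blast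
  then have "f ` (inv f \<circ> g) ` {0..dist x' y'} \<subseteq> f ` A" by blast
  then show "g ` {0..dist x y} \<subseteq> f ` A"
    using f by (simp add: image_image x' y' isometry_dist)
qed

text \<open>The isometry f carries the wall of r and its two complementary components to those of
  the conjugate. In a group of isometries the set of reflections is therefore stable under
  conjugation.\<close>

lemma reflection_conj:
  assumes r: "reflection r" and f: "isometry f"
  shows "reflection (f \<circ> r \<circ> inv f)"
proof -
  let ?r = "f \<circ> r \<circ> inv f"
  obtain A B where AB: "A \<noteq> B" "components (- wall r) = {A, B}" "geo_convex A" "geo_convex B"
    "r ` A = B" "r ` B = A"
    using r unfolding reflection_def by (elim conjE exE) (rule that)
  have iso: "isometry r" and inv: "r \<circ> r = id" and int: "interior (wall r) = {}"
    using r by (simp_all add: reflection_def)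
  have wall: "wall ?r = f ` wall r"
  proof (intro set_eqI iffI)
    fix x assume "x \<in> wall ?r"
    then have "f (r (inv f x)) = x" by (simp add: wall_def)
    then have "inv f x \<in> wall r" using isometry_inv_f[OF f, of "r (inv f x)"] by (simp add: wall_def)
    then have "f (inv f x) \<in> f ` wall r" by (rule imageI)
    then show "x \<in> f ` wall r" using f by simp
  qed (use f in \<open>auto simp: wall_def\<close>)
  have "- wall ?r = f ` (- wall r)"
    unfolding wall using isometry_bij[OF f] by (simp add: bij_image_Compl_eq)
  then have "components (- wall ?r) = {f ` A, f ` B}"
    using components_isometry_image[OF f] AB(2) by simp
  moreover have "f ` A \<noteq> f ` B"
    using AB(1) isometry_bij[OF f] by (simp add: bij_is_inj inj_image_eq_iff)
  moreover have "?r ` f ` Y = f ` (r ` Y)" for Y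
    using f by (simp add: image_image)
  then have "?r ` f ` A = f ` B" "?r ` f ` B = f ` A"
    by (simp_all only: AB(5,6))
  moreover have "interior (wall ?r) = {}"
  proof -
    have "homeomorphism UNIV UNIV f (inv f)"
      using homeomorphism_isometry[OF f, of UNIV] f by (simp add: isometry_def)
    then have "open (inv f ` interior (wall ?r))"
      using homeomorphism_imp_open_map[OF homeomorphism_symD, of UNIV UNIV f "inv f" "interior (wall ?r)"]
      by (simp add: open_openin[symmetric])
    moreover have "inv f ` interior (wall ?r) \<subseteq> wall r"
      using interior_subset[of "wall ?r"] f unfolding wall by auto
    ultimately have "inv f ` interior (wall ?r) = {}"
      using interior_maximal int by blast
    then show ?thesis by simp
  qed
  moreover have "isometry ?r"
    by (intro isometry_comp isometry_inv iso f)
  moreover have "?r \<circ> ?r = id"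
  proof
    fix x
    have "r (r (inv f x)) = inv f x" using inv by (metis comp_apply id_apply)
    then show "(?r \<circ> ?r) x = id x" using f by simp
  qed
  ultimately show ?thesis
    unfolding reflection_def using geo_convex_isometry_image[OF f AB(3)] geo_convex_isometry_image[OF f AB(4)]
    by (intro conjI exI[of _ "f ` A"] exI[of _ "f ` B"])
qed

text \<open>Half-spaces are named by a base point, so that the opposite half-space is again of this
  form, with base point \<open>r p\<close>. The set is empty if p lies on the wall.\<close>

definition side :: "('a::metric_space \<Rightarrow> 'a) \<Rightarrow> 'a \<Rightarrow> 'a set" where
  "side r p = connected_component_set (- wall r) p"

definition closed_side :: "('a::metric_space \<Rightarrow> 'a) \<Rightarrow> 'a \<Rightarrow> 'a set" where
  "closed_side r p = side r p \<union> wall r"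

lemma side_self: "p \<notin> wall r \<Longrightarrow> p \<in> side r p"
  by (simp add: side_def)

lemma side_eq: "x \<in> side r p \<Longrightarrow> side r x = side r p"
  unfolding side_def by (rule connected_component_eq)

lemma side_not_wall: "x \<in> side r p \<Longrightarrow> x \<notin> wall r"
  unfolding side_def using connected_component_in[of "- wall r" p x] by simp

lemma side_maximal:
  assumes "connected A" "A \<subseteq> - wall r" "x \<in> A" "x \<in> side r p"
  shows "A \<subseteq> side r p"
  using connected_component_maximal[OF assms(3,1,2)] side_eq[OF assms(4)] by (simp add: side_def)

lemma reflection_isometry: "reflection r \<Longrightarrow> isometry r"
  by (simp add: reflection_def)

lemma reflection_interior_wall: "reflection r \<Longrightarrow> interior (wall r) = {}"
  by (simp add: reflection_def)

lemma reflection_reflection: "reflection r \<Longrightarrow> r (r x) = x"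
  unfolding reflection_def by (metis comp_apply id_apply)

lemma reflection_inv: "reflection r \<Longrightarrow> inv r = r"
  by (metis inv_unique_comp reflection_def)

lemma reflection_not_wall: "reflection r \<Longrightarrow> x \<notin> wall r \<Longrightarrow> r x \<notin> wall r"
  by (auto simp: wall_def reflection_reflection)

lemma closed_wall: "reflection r \<Longrightarrow> closed (wall r)"
  unfolding wall_def
  by (rule closed_Collect_eq) (auto intro: continuous_on_isometry reflection_isometry continuous_on_id)

lemma reflection_sides:
  assumes r: "reflection r" and p: "p \<notin> wall r"
  shows "geo_convex (side r p)" "components (- wall r) = {side r p, r ` side r p}"
    "r ` side r p \<noteq> side r p"
proof -
  obtain A B where AB: "A \<noteq> B" "components (- wall r) = {A, B}" "geo_convex A" "geo_convex B"
    "r ` A = B" "r ` B = A"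
    using r unfolding reflection_def by (elim conjE exE) (rule that)
  have "side r p \<in> components (- wall r)" unfolding side_def using p by (simp add: componentsI)
  then have "side r p = A \<or> side r p = B" using AB(2) by simp
  then show "geo_convex (side r p)" "components (- wall r) = {side r p, r ` side r p}"
    "r ` side r p \<noteq> side r p"
    by (elim disjE; simp only: AB insert_commute AB(1)[symmetric] simp_thms)+
qed

lemma reflection_leaves_side:
  assumes r: "reflection r" and x: "x \<in> side r p"
  shows "r x \<notin> side r p"
proof
  assume "r x \<in> side r p"
  have p: "p \<notin> wall r" using x connected_component_in[of "- wall r" p x] by (simp add: side_def)
  have "side r p \<in> components (- wall r)" "r ` side r p \<in> components (- wall r)"
    by (simp_all add: reflection_sides(2)[OF r p])
  then have "side r p \<inter> r ` side r p = {}"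
    using components_nonoverlap reflection_sides(3)[OF r p] by metis
  moreover have "r x \<in> side r p \<inter> r ` side r p"
    using x \<open>r x \<in> side r p\<close> by (intro IntI imageI)
  ultimately show False by simp
qed

lemma reflection_enters_side:
  assumes r: "reflection r" and p: "p \<notin> wall r" and x: "x \<notin> closed_side r p"
  shows "r x \<in> side r p"
proof -
  have "x \<in> \<Union>(components (- wall r))" using x by (simp add: closed_side_def)
  then have "x \<in> side r p \<union> r ` side r p" by (simp add: reflection_sides(2)[OF r p])
  then have "x \<in> r ` side r p" using x by (simp add: closed_side_def)
  then obtain z where "x = r z" "z \<in> side r p" by (rule imageE)
  then show ?thesis by (simp add: reflection_reflection[OF r])
qed

text \<open>Presents the complement of a closed half-space as an open half-space, so that statements
  about \<open>side\<close> yield those about \<open>closed_side\<close>.\<close>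

lemma not_closed_side_iff:
  assumes "reflection r" "p \<notin> wall r"
  shows "x \<notin> closed_side r p \<longleftrightarrow> x \<in> side r (r p)"
proof
  assume x: "x \<notin> closed_side r p"
  have comp: "r ` side r p \<in> components (- wall r)"
    by (simp add: reflection_sides(2)[OF assms])
  have "r p \<in> r ` side r p" by (intro imageI side_self assms)
  moreover have "r p \<in> side r (r p)" by (intro side_self reflection_not_wall assms)
  ultimately have "r ` side r p \<subseteq> side r (r p)"
    by (rule side_maximal[OF in_components_connected[OF comp] in_components_subset[OF comp]])
  moreover have "r (r x) \<in> r ` side r p"
    by (intro imageI reflection_enters_side assms x)
  ultimately have "r (r x) \<in> side r (r p)" by (rule subsetD)
  then show "x \<in> side r (r p)" by (simp only: reflection_reflection[OF assms(1)])
next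
  assume x: "x \<in> side r (r p)"
  have "r p \<notin> side r p" by (intro reflection_leaves_side side_self assms)
  moreover have "r p \<in> side r (r p)" by (intro side_self reflection_not_wall assms)
  ultimately have "side r p \<noteq> side r (r p)" by metis
  then have "x \<notin> side r p" using side_eq[OF x] side_eq[of x r p] by metis
  then show "x \<notin> closed_side r p" using side_not_wall[OF x] by (simp add: closed_side_def)
qed

section \<open>Topology and convexity of half-spaces\<close>

context CAT0_space
begin

lemma open_side:
  assumes r: "reflection (r :: 'a \<Rightarrow> 'a)"
  shows "open (side r p)"
  unfolding open_contains_ball
proof
  fix x assume x: "x \<in> side r p"
  then have "x \<in> - wall r" using side_not_wall by (metis ComplI)
  then obtain e where e: "e > 0" "ball x e \<subseteq> - wall r"
    using closed_wall[OF r] open_contains_ball by blast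
  then have "ball x e \<subseteq> side r p"
    using side_maximal[OF connected_ball_CAT0 e(2) _ x] by simp
  then show "\<exists>e>0. ball x e \<subseteq> side r p" using e by blast
qed

lemma closed_closed_side:
  assumes "reflection (r :: 'a \<Rightarrow> 'a)" "p \<notin> wall r"
  shows "closed (closed_side r p)"
proof -
  have "- closed_side r p = side r (r p)" by (intro set_eqI) (simp add: not_closed_side_iff[OF assms])
  then show ?thesis using open_side[OF assms(1)] by (simp add: closed_def)
qed

text \<open>As the wall has empty interior, there is a point z off the wall arbitrarily close to a
  wall point x. Either z or r z lies on the side of p, and both are equally far from x because r
  fixes x.\<close>

lemma closed_side_approx:
  assumes r: "reflection (r :: 'a \<Rightarrow> 'a)" and p: "p \<notin> wall r"
    and x: "x \<in> closed_side r p" and e: "e > 0"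
  shows "\<exists>x'\<in>side r p. dist x x' < e"
proof (cases "x \<in> side r p")
  case False
  then have "x \<in> wall r" using x by (simp add: closed_side_def)
  have "\<not> ball x e \<subseteq> wall r"
    using interior_maximal[of "ball x e" "wall r"] reflection_interior_wall[OF r] e by auto
  then obtain z where z: "dist x z < e" "z \<notin> wall r" by (meson mem_ball subsetI)
  have d: "dist x (r z) = dist x z"
    using isometry_dist[OF reflection_isometry[OF r], of x z] \<open>x \<in> wall r\<close> by (simp add: wall_def)
  have "z \<in> side r p \<or> r z \<in> side r p"
    using reflection_enters_side[OF r p, of z] z(2) unfolding closed_side_def by blast
  then show ?thesis
  proof
    assume "r z \<in> side r p"
    then show ?thesis using d z(1) by (intro bexI[of _ "r z"]) simp_all
  qed (use z(1) in blast)
next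
  case True
  then show ?thesis using e by (intro bexI[of _ x]) auto
qed

text \<open>Geodesics depend continuously on their end points. If one left the closed half-space, it
  would enter the open opposite side, and so would a geodesic between nearby points of the open
  side, which is convex.\<close>

lemma geo_convex_closed_side:
  assumes r: "reflection (r :: 'a \<Rightarrow> 'a)" and p: "p \<notin> wall r"
  shows "geo_convex (closed_side r p)"
proof (rule geo_convexI, rule ccontr)
  fix x y a assume xy: "x \<in> closed_side r p" "y \<in> closed_side r p" and a: "a \<in> {0..1::real}"
    and "geo x y a \<notin> closed_side r p"
  then have "geo x y a \<in> side r (r p)" by (simp add: not_closed_side_iff[OF r p])
  then obtain e where e: "e > 0" "ball (geo x y a) e \<subseteq> side r (r p)"
    using open_side[OF r] open_contains_ball by blast
  obtain x' y' where xy': "x' \<in> side r p" "y' \<in> side r p" "dist x x' < e" "dist y y' < e"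
    using closed_side_approx[OF r p xy(1) e(1)] closed_side_approx[OF r p xy(2) e(1)] by blast
  have "dist (geo x y a) (geo x' y' a) \<le> (1 - a) * dist x x' + a * dist y y'"
    by (rule dist_geo_convex[OF a])
  also have "\<dots> < e"
    by (rule convex_bound_lt) (use xy' a in auto)
  finally have "geo x' y' a \<in> side r (r p)" using e(2) by (meson mem_ball subsetD)
  moreover have "geo x' y' a \<in> side r p"
    by (rule geo_convexD[OF reflection_sides(1)[OF r p] xy'(1,2) a])
  ultimately show False using not_closed_side_iff[OF r p, of "geo x' y' a"] by (simp add: closed_side_def)
qed

lemma geo_meets_wall:
  assumes "y \<notin> side r p" "p \<notin> wall r"
  shows "\<exists>b\<in>{0..1}. geo p (y::'a) b \<in> wall r"
proof (rule ccontr)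
  assume no: "\<not> ?thesis"
  have c: "connected (geo p y ` {0..1})"
    by (intro connected_continuous_image continuous_on_geo) simp
  have "p \<in> geo p y ` {0..1}" by (rule image_eqI[where x = 0]) simp_all
  moreover have "geo p y ` {0..1} \<subseteq> - wall r" using no by blast
  ultimately have "geo p y ` {0..1} \<subseteq> side r p"
    using side_maximal[OF c _ _ side_self[OF assms(2)]] by simp
  moreover have "y \<in> geo p y ` {0..1}" by (rule image_eqI[where x = 1]) simp_all
  ultimately have "y \<in> side r p" by (rule subsetD)
  then show False using assms by simp
qed

text \<open>If equality held, the wall point where \<open>[p, y]\<close> crosses would lie on the geodesic from \<open>p\<close>
  to \<open>r y\<close>, contradicting convexity of the open half-space.\<close>
lemma dist_reflection_less:
  assumes r: "reflection (r :: 'a \<Rightarrow> 'a)" and p: "p \<notin> wall r" and y: "y \<notin> closed_side r p"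
  shows "dist p (r y) < dist p y"
proof (rule ccontr)
  assume neg: "\<not> ?thesis"
  obtain b where b: "b \<in> {0..1}" "geo p y b \<in> wall r"
    using geo_meets_wall[OF _ p] y unfolding closed_side_def by blast
  define q where "q = geo p y b"
  have "r q = q" using b by (simp add: wall_def q_def)
  then have "dist q (r y) = dist q y"
    by (metis isometry_dist reflection_isometry[OF r])
  moreover have "dist p q + dist q y = dist p y"
    using dist_geo_start[OF b(1)] dist_geo_end[OF b(1)] by (simp add: q_def algebra_simps)
  ultimately have eq: "dist p q + dist q (r y) = dist p (r y)"
    using neg dist_triangle[of p "r y" q] by simp
  then have q: "q = geo p (r y) (dist p q / dist p (r y))" by (rule geo_unique_dist)
  have "dist p q \<le> dist p (r y)"
    using eq zero_le_dist[of q "r y"] by linarith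
  then have "dist p q / dist p (r y) \<in> {0..1}"
    by (simp add: divide_le_eq_1)
  then have "q \<in> side r p"
    by (subst q) (rule geo_convexD[OF reflection_sides(1)[OF r p] side_self[OF p]
        reflection_enters_side[OF r p y]])
  then show False using b(2) side_not_wall unfolding q_def by metis
qed

end

section \<open>Groups of isometries and chambers\<close>

lemma gen_grp_base: "g \<in> G \<Longrightarrow> g \<in> gen_grp G"
  using gen_mul[OF _ gen_id, of g G] by simp

lemma gen_grp_inv_base: "g \<in> G \<Longrightarrow> inv g \<in> gen_grp G"
  using gen_inv[OF _ gen_id, of g G] by simp

lemma gen_grp_comp: "v \<in> gen_grp G \<Longrightarrow> w \<in> gen_grp G \<Longrightarrow> v \<circ> w \<in> gen_grp G"
  by (induction rule: gen_grp.induct) (auto simp: comp_assoc intro: gen_grp.intros)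

lemma gen_grp_isometry:
  assumes "\<And>g. g \<in> G \<Longrightarrow> isometry g" "w \<in> gen_grp G"
  shows "isometry w"
  using assms(2)
proof (induction rule: gen_grp.induct)
  case gen_id
  show ?case by (rule isometry_id)
next
  case (gen_mul g w)
  then show ?case by (intro isometry_comp[OF assms(1)])
next
  case (gen_inv g w)
  then show ?case by (intro isometry_comp[OF isometry_inv[OF assms(1)]])
qed

lemma gen_grp_inv:
  assumes iso: "\<And>g. g \<in> G \<Longrightarrow> isometry g" and w: "w \<in> gen_grp G"
  shows "inv w \<in> gen_grp G"
  using w
proof (induction rule: gen_grp.induct)
  case gen_id
  show ?case unfolding inv_id by (rule gen_grp.gen_id)
next
  case (gen_mul g w)
  have "inv (g \<circ> w) = inv w \<circ> inv g"
    by (intro o_inv_distrib isometry_bij iso gen_mul gen_grp_isometry[OF iso gen_mul(2)])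
  then show ?case using gen_grp_comp[OF gen_mul(3) gen_grp_inv_base[OF gen_mul(1)]] by metis
next
  case (gen_inv g w)
  have "inv (inv g \<circ> w) = inv w \<circ> inv (inv g)"
    by (intro o_inv_distrib isometry_bij isometry_inv iso gen_inv gen_grp_isometry[OF iso gen_inv(2)])
  then show ?case
    using gen_grp_comp[OF gen_inv(3) gen_grp_base[OF gen_inv(1)]]
      inv_inv_eq[OF isometry_bij[OF iso[OF gen_inv(1)]]] by metis
qed

text \<open>Abstracts from generators, since the minimisation over orbits is applied to W, to
  special subgroups and to point stabilizers.\<close>

definition fun_group :: "('a \<Rightarrow> 'a) set \<Rightarrow> bool" where
  "fun_group V \<longleftrightarrow> id \<in> V \<and> (\<forall>v\<in>V. \<forall>w\<in>V. v \<circ> w \<in> V) \<and> (\<forall>v\<in>V. inv v \<in> V)"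

lemma fun_group_gen_grp: "(\<And>g. g \<in> G \<Longrightarrow> isometry g) \<Longrightarrow> fun_group (gen_grp G)"
  unfolding fun_group_def by (simp add: gen_id gen_grp_comp gen_grp_inv)

section \<open>The chamber of a base point and the local structure of the walls\<close>

locale reflection_chamber = CAT0_space X for X :: "'a::metric_space itself" +
  fixes W :: "('a \<Rightarrow> 'a) set" and C :: "'a set" and p :: 'a
  assumes cocompact: "cocompact_discrete_refl_group W"
    and chamber: "chamber W C" and p: "p \<in> C"
begin

definition walls :: "'a set" where
  "walls = (\<Union>r\<in>refls W. wall r)"

lemma W_isometry_group: "fun_group W" "w \<in> W \<Longrightarrow> isometry w"
proof -
  obtain G where "\<And>g. g \<in> G \<Longrightarrow> reflection g" "W = gen_grp G"
    using cocompact unfolding cocompact_discrete_refl_group_def reflection_group_def by blast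
  then show "fun_group W" "w \<in> W \<Longrightarrow> isometry w"
    by (simp_all add: fun_group_gen_grp gen_grp_isometry[of G] reflection_isometry)
qed

lemma W_id: "id \<in> W" and W_comp: "v \<in> W \<Longrightarrow> w \<in> W \<Longrightarrow> v \<circ> w \<in> W" and W_inv: "w \<in> W \<Longrightarrow> inv w \<in> W"
  using W_isometry_group(1) by (simp_all add: fun_group_def)

lemma refls_W: "r \<in> refls W \<Longrightarrow> r \<in> W" and refls_reflection: "r \<in> refls W \<Longrightarrow> reflection r"
  by (simp_all add: refls_def)

lemma compact_closure_C: "compact (closure C)"
  using cocompact chamber unfolding cocompact_discrete_refl_group_def by blast

lemma stabilizer_C: "w \<in> W \<Longrightarrow> w ` C = C \<Longrightarrow> w = id"
  using cocompact chamber unfolding cocompact_discrete_refl_group_def by blast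

lemma finite_close: "finite {w\<in>W. dist x (w y) < N}"
proof -
  have "acts_properly W" using cocompact unfolding cocompact_discrete_refl_group_def by blast
  \<comment> \<open>Properness speaks of one point only; enlarging the radius by
    \<open>dist y x\<close> allows two. The absolute value and the 1 keep the radius positive for
    every N.\<close>
  then have "finite {w\<in>W. w y \<in> ball y (\<bar>N\<bar> + dist y x + 1)}"
    unfolding acts_properly_def by (simp add: add_nonneg_pos)
  then show ?thesis
  proof (rule finite_subset[rotated], intro subsetI CollectI conjI)
    fix w assume w: "w \<in> {w\<in>W. dist x (w y) < N}"
    have "dist y (w y) \<le> dist y x + dist x (w y)" by (rule dist_triangle)
    also have "dist x (w y) < \<bar>N\<bar> + 1" using w by auto
    finally show "w y \<in> ball y (\<bar>N\<bar> + dist y x + 1)" by (simp add: algebra_simps)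
  qed simp
qed

lemma refls_conj: "w \<in> W \<Longrightarrow> r \<in> refls W \<Longrightarrow> w \<circ> r \<circ> inv w \<in> refls W"
  by (simp add: refls_def W_comp W_inv reflection_conj W_isometry_group(2))

text \<open>If r fixes w x, its conjugate by the inverse of w is a reflection in W that fixes
  x.\<close>

lemma not_walls_image:
  assumes w: "w \<in> W" and x: "x \<notin> walls"
  shows "w x \<notin> walls"
proof
  assume "w x \<in> walls"
  then obtain r where r: "r \<in> refls W" "r (w x) = w x" by (auto simp: walls_def wall_def)
  have iso: "isometry w" by (rule W_isometry_group(2)[OF w])
  have "inv w \<circ> r \<circ> inv (inv w) \<in> refls W" by (intro refls_conj W_inv w r)
  moreover have "inv (inv w) = w" using isometry_bij[OF iso] by (rule inv_inv_eq)
  moreover have "x \<in> wall (inv w \<circ> r \<circ> w)" using r(2) iso by (simp add: wall_def)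
  ultimately show False using x by (auto simp: walls_def)
qed

lemma C_component: "C = connected_component_set (- walls) p"
proof -
  have "C \<in> components (- walls)" using chamber by (simp add: chamber_def walls_def)
  then obtain x where "C = connected_component_set (- walls) x" by (rule componentsE)
  then show ?thesis using p connected_component_eq[of p "- walls" x] by simp
qed

lemma C_not_walls: "x \<in> C \<Longrightarrow> x \<notin> walls"
  using C_component connected_component_subset[of "- walls" p] by blast

lemma p_not_wall: "r \<in> refls W \<Longrightarrow> p \<notin> wall r"
  using C_not_walls[OF p] by (auto simp: walls_def)

text \<open>For the inclusion from right to left, the intersection of sides is convex, hence
  connected; it contains p and avoids all walls, so it stays in the component of p.\<close>

lemma C_eq: "C = (\<Inter>r\<in>refls W. side r p)"
proof
  have "C \<subseteq> side r p" if r: "r \<in> refls W" for r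
  proof (rule side_maximal)
    show "connected C" by (subst C_component) simp
    show "C \<subseteq> - wall r" using C_not_walls r by (auto simp: walls_def)
  qed (rule p, rule side_self, rule p_not_wall, rule r)
  then show "C \<subseteq> (\<Inter>r\<in>refls W. side r p)" by blast
next
  let ?A = "\<Inter>r\<in>refls W. side r p"
  have "geo_convex ?A"
    by (rule geo_convexI)
       (blast intro: geo_convexD[OF reflection_sides(1)[OF refls_reflection p_not_wall]])
  then have "connected ?A" by (rule connected_geo_convex)
  moreover have "p \<in> ?A" by (intro INT_I side_self p_not_wall)
  moreover have "?A \<subseteq> - walls" using side_not_wall by (auto simp: walls_def)
  ultimately show "?A \<subseteq> C"
    by (subst C_component) (rule connected_component_maximal)
qed

lemma C_side: "x \<in> C \<Longrightarrow> r \<in> refls W \<Longrightarrow> x \<in> side r p"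
  using C_eq by blast

lemma min_dist_orbit:
  assumes V: "V \<subseteq> W" "V \<noteq> {}"
  shows "\<exists>w\<in>V. \<forall>v\<in>V. dist p (w x) \<le> dist p (v x)"
proof -
  obtain u where u: "u \<in> V" using V by blast
  \<comment> \<open>By properness only finitely many elements compete with u; the added 1 puts u
    itself into F.\<close>
  define F where "F = {v\<in>V. dist p (v x) < dist p (u x) + 1}"
  have "finite F"
    by (rule finite_subset[OF _ finite_close[of p x "dist p (u x) + 1"]]) (use V in \<open>auto simp: F_def\<close>)
  moreover have "u \<in> F" using u by (simp add: F_def)
  moreover define w where "w = arg_min_on (\<lambda>v. dist p (v x)) F"
  ultimately have w: "w \<in> F" "dist p (w x) \<le> dist p (v x)" if "v \<in> F" for v
    using arg_min_if_finite[of F "\<lambda>v. dist p (v x)"] that by (force simp: not_less)+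
  have "dist p (w x) \<le> dist p (v x)" if "v \<in> V" for v
  proof (cases "v \<in> F")
    case False
    then show ?thesis using that w(2)[OF \<open>u \<in> F\<close>] by (simp add: F_def)
  qed (rule w(2))
  then show ?thesis using w(1)[OF \<open>u \<in> F\<close>] by (auto simp: F_def)
qed

lemma min_dist_closed_side:
  assumes V: "fun_group V" and w: "w \<in> V" "\<And>v. v \<in> V \<Longrightarrow> dist p (w x) \<le> dist p (v x)"
    and r: "r \<in> refls W" "r \<in> V"
  shows "w x \<in> closed_side r p"
proof (rule ccontr)
  assume "w x \<notin> closed_side r p"
  then have "dist p (r (w x)) < dist p (w x)"
    by (rule dist_reflection_less[OF refls_reflection[OF r(1)] p_not_wall[OF r(1)]])
  moreover have "r \<circ> w \<in> V" using V r(2) w(1) by (simp add: fun_group_def)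
  ultimately show False using w(2)[of "r \<circ> w"] by simp
qed

lemma finite_refls_at: "finite {r\<in>refls W. y \<in> wall r}"
  by (rule finite_subset[OF _ finite_close[of y y 1]]) (auto simp: refls_def wall_def)

text \<open>A reflection whose wall contains a point z moves y by at most twice
  \<open>dist y z\<close>. Close to y there are only finitely many images of y, so a wall that comes
  close enough must fix y. The bound 1 selects a finite set of images, and d is a lower bound for
  the distances from y to those different from y.\<close>

lemma locally_finite_walls: "\<exists>e>0. \<forall>r\<in>refls W. wall r \<inter> ball y e \<noteq> {} \<longrightarrow> y \<in> wall r"
proof -
  define F where "F = (\<lambda>r. r y) ` {w\<in>W. dist y (w y) < 1}"
  have "finite F" unfolding F_def by (intro finite_imageI finite_close)
  then obtain d where d: "d > 0" "\<And>x. x \<in> F \<Longrightarrow> x \<noteq> y \<Longrightarrow> d \<le> dist y x"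
    using finite_set_avoid[of F y] by metis
  have "y \<in> wall r" if r: "r \<in> refls W" and ne: "wall r \<inter> ball y (min d 1 / 2) \<noteq> {}" for r
  proof (rule ccontr)
    assume "y \<notin> wall r"
    obtain z where "z \<in> wall r" "z \<in> ball y (min d 1 / 2)" using ne by blast
    then have z: "r z = z" "dist y z < min d 1 / 2" by (simp_all add: wall_def)
    have "dist z (r y) = dist z y"
      by (metis isometry_dist reflection_isometry refls_reflection r z(1))
    then have "dist y (r y) < min d 1"
      using z(2) dist_triangle[of y "r y" z] by (simp add: dist_commute)
    moreover have "r y \<noteq> y" using \<open>y \<notin> wall r\<close> by (simp add: wall_def)
    ultimately show False using d(2)[of "r y"] r by (auto simp: F_def refls_def)
  qed
  then show ?thesis using d(1) by (intro exI[of _ "min d 1 / 2"]) auto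
qed

lemma ball_side:
  assumes e: "\<forall>r\<in>refls W. wall r \<inter> ball y e \<noteq> {} \<longrightarrow> y \<in> wall r" "e > 0"
    and r: "r \<in> refls W" "y \<in> side r q"
  shows "ball y e \<subseteq> side r q"
proof (rule side_maximal[OF connected_ball_CAT0])
  show "ball y e \<subseteq> - wall r" using e(1) r side_not_wall by blast
qed (use e(2) r(2) in auto)

lemma interior_Union_walls_at: "finite F \<Longrightarrow> F \<subseteq> refls W \<Longrightarrow> interior (\<Union>r\<in>F. wall r) = {}"
proof (induction rule: finite_induct)
  case (insert r F)
  then have r: "reflection r" by (simp add: refls_reflection)
  have "interior (wall r \<union> (\<Union>r\<in>F. wall r)) = interior (wall r)"
    by (rule interior_closed_Un_empty_interior[OF closed_wall[OF r]]) (use insert in simp)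
  then show ?case using reflection_interior_wall[OF r] by simp
qed simp

text \<open>In a small ball about y only the walls through y occur. They are finitely many closed
  sets with empty interior, so their union cannot fill the ball.\<close>

lemma not_walls_dense:
  assumes "d > 0"
  shows "\<exists>x. dist y x < d \<and> x \<notin> walls"
proof -
  obtain e where e: "e > 0" "\<forall>r\<in>refls W. wall r \<inter> ball y e \<noteq> {} \<longrightarrow> y \<in> wall r"
    using locally_finite_walls by blast
  let ?U = "\<Union>r\<in>{r\<in>refls W. y \<in> wall r}. wall r"
  have "interior ?U = {}" by (rule interior_Union_walls_at[OF finite_refls_at]) blast
  then have "\<not> ball y (min d e) \<subseteq> ?U"
    using interior_maximal[OF _ open_ball, of y "min d e" ?U] e(1) assms by auto
  then obtain x where x: "x \<in> ball y (min d e)" "x \<notin> ?U" by blast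
  then have "x \<in> ball y e" by simp
  then have "x \<notin> walls" using x(2) e(2) unfolding walls_def by blast
  then show ?thesis using x(1) by auto
qed

text \<open>The harder inclusion takes y in all closed sides and a point x off the walls near y. The
  stabilizer of y moves x without changing its distance to y, and minimising the distance to p
  brings it to the right side of the walls through y. The other walls do not meet the ball about
  y.\<close>

lemma closure_C: "closure C = (\<Inter>r\<in>refls W. closed_side r p)"
proof
  show "closure C \<subseteq> (\<Inter>r\<in>refls W. closed_side r p)"
  proof (rule closure_minimal)
    show "C \<subseteq> (\<Inter>r\<in>refls W. closed_side r p)" using C_side by (auto simp: closed_side_def)
    show "closed (\<Inter>r\<in>refls W. closed_side r p)"
      by (intro closed_INT ballI closed_closed_side refls_reflection p_not_wall)
  qed
next
  show "(\<Inter>r\<in>refls W. closed_side r p) \<subseteq> closure C"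
  proof
    fix y assume y: "y \<in> (\<Inter>r\<in>refls W. closed_side r p)"
    obtain e where e: "e > 0" "\<forall>r\<in>refls W. wall r \<inter> ball y e \<noteq> {} \<longrightarrow> y \<in> wall r"
      using locally_finite_walls by blast
    define V where "V = {w\<in>W. w y = y}"
    have "inv w y = y" if "w \<in> V" for w
      using that isometry_inv_f[OF W_isometry_group(2), of w y] by (simp add: V_def)
    then have V: "fun_group V" "V \<subseteq> W" "id \<in> V"
      by (auto simp: fun_group_def V_def W_id W_comp W_inv)
    show "y \<in> closure C"
      unfolding closure_approachable
    proof (intro allI impI)
      fix d :: real assume "d > 0"
      then obtain x where x: "dist y x < min d e" "x \<notin> walls"
        using not_walls_dense[of "min d e" y] e(1) by auto
      obtain w where w: "w \<in> V" "\<forall>v\<in>V. dist p (w x) \<le> dist p (v x)"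
        using min_dist_orbit[OF V(2), of x] V(3) by blast
      have wW: "w \<in> W" "w y = y" using w(1) by (simp_all add: V_def)
      then have dw: "dist y (w x) = dist y x"
        by (metis isometry_dist W_isometry_group(2))
      have "w x \<in> side r p" if r: "r \<in> refls W" for r
      proof (cases "y \<in> wall r")
        case True
        then have "r \<in> V" using r by (simp add: V_def refls_def wall_def)
        then have "w x \<in> closed_side r p"
          using min_dist_closed_side[OF V(1) w(1) _ r] w(2) by blast
        moreover have "w x \<notin> wall r" using not_walls_image[OF wW(1) x(2)] r by (auto simp: walls_def)
        ultimately show ?thesis by (simp add: closed_side_def)
      next
        case False
        then have "y \<in> side r p" using y r by (auto simp: closed_side_def)
        then have "ball y e \<subseteq> side r p" by (rule ball_side[OF e(2,1) r])
        then show ?thesis using dw x(1) by auto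
      qed
      then have "w x \<in> C" unfolding C_eq by blast
      then show "\<exists>z\<in>C. dist z y < d"
        using dw x(1) by (intro bexI[of _ "w x"]) (simp_all add: dist_commute)
    qed
  qed
qed

text \<open>In the orbit of y under V, a point closest to p satisfies the conditions of reflections
  in V by minimality, and the others by hypothesis. For V = W the hypothesis is vacuous, which gives
  \<open>W_cover\<close>.\<close>

lemma orbit_of_closure_C:
  assumes V: "fun_group V" "V \<subseteq> W"
    and y: "\<And>w r. w \<in> V \<Longrightarrow> r \<in> refls W \<Longrightarrow> r \<notin> V \<Longrightarrow> w y \<in> closed_side r p"
  shows "y \<in> (\<Union>w\<in>V. w ` closure C)"
proof -
  have "V \<noteq> {}" using V(1) by (auto simp: fun_group_def)
  then obtain w where w: "w \<in> V" "\<forall>v\<in>V. dist p (w y) \<le> dist p (v y)"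
    using min_dist_orbit[OF V(2), of y] by blast
  have "w y \<in> closed_side r p" if "r \<in> refls W" for r
    using y[OF w(1) that] min_dist_closed_side[OF V(1) w(1) _ that] w(2) by blast
  then have "w y \<in> closure C" unfolding closure_C by blast
  moreover have "inv w (w y) = y" using w(1) V(2) by (simp add: W_isometry_group(2) subsetD)
  moreover have "inv w \<in> V" using w(1) V(1) by (simp add: fun_group_def)
  ultimately show ?thesis by (metis UN_I imageI)
qed

lemma W_cover: "UNIV = (\<Union>w\<in>W. w ` closure C)"
  using orbit_of_closure_C[OF W_isometry_group(1)] by (auto simp: refls_def)

text \<open>The complement of the walls is invariant under w, so w C is one of its components. It
  meets C, hence equals C, and the stabilizer of a chamber is trivial.\<close>

lemma chamber_image_eq:
  assumes w: "w \<in> W" and x: "x \<in> C" "w x \<in> C"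
  shows "w = id"
proof (rule stabilizer_C[OF w])
  have iso: "isometry w" by (rule W_isometry_group(2)[OF w])
  have "w ` (- walls) = - walls"
  proof
    show "w ` (- walls) \<subseteq> - walls" using not_walls_image[OF w] by blast
    show "- walls \<subseteq> w ` (- walls)"
    proof
      fix z assume "z \<in> - walls"
      then have "inv w z \<in> - walls" using not_walls_image[OF W_inv[OF w]] by simp
      then have "w (inv w z) \<in> w ` (- walls)" by (rule imageI)
      then show "z \<in> w ` (- walls)" using iso by simp
    qed
  qed
  moreover have C: "C \<in> components (- walls)" using chamber by (simp add: chamber_def walls_def)
  ultimately have "w ` C \<in> components (- walls)"
    using components_isometry_image[OF iso, of "- walls"] by (metis imageI)
  moreover have "w ` C \<inter> C \<noteq> {}" using x by blast
  ultimately show "w ` C = C" using components_eq[OF _ C] by metis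
qed

end

section \<open>Rays\<close>

text \<open>\<open>dist x (z n)\<close> differs from n by a bounded amount. Hence on the geodesic
  from x to \<open>z n\<close> the parameter t / n is asymptotically the same as arc length
  t.\<close>

lemma (in CAT0_space) tendsto_dist_quotient:
  assumes c: "geodesic_ray c" and z: "\<And>n. dist (z n) (c (real n)) \<le> B"
  shows "(\<lambda>n. dist x (z n :: 'a) / real n) \<longlonglongrightarrow> 1"
proof -
  define K where "K = dist x (c 0) + B"
  have K: "dist x (z n) \<le> real n + K \<and> real n - K \<le> dist x (z n)" for n
  proof -
    have "dist (c 0) (c (real n)) = real n" using c by (simp add: geodesic_ray_def)
    then show ?thesis
      using z[of n] dist_triangle[of "c 0" "c (real n)" x] dist_triangle[of x "c (real n)" "z n"]
        dist_triangle[of x "z n" "c (real n)"] dist_triangle[of x "c (real n)" "c 0"]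
      unfolding K_def by (simp add: dist_commute)
  qed
  have b: "1 - K / real n \<le> dist x (z n) / real n" "dist x (z n) / real n \<le> 1 + K / real n"
    if "n > 0" for n
    using that K[of n] divide_right_mono[of "real n - K" "dist x (z n)" "real n"]
      divide_right_mono[of "dist x (z n)" "real n + K" "real n"]
    by (simp_all add: diff_divide_distrib add_divide_distrib)
  have l: "(\<lambda>n. 1 - K / real n) \<longlonglongrightarrow> 1 - 0" "(\<lambda>n. 1 + K / real n) \<longlonglongrightarrow> 1 + 0"
    by (intro tendsto_intros lim_const_over_n)+
  show ?thesis
    by (rule tendsto_sandwich[of "\<lambda>n. 1 - K / real n" _ _ "\<lambda>n. 1 + K / real n"])
       (use l b in \<open>auto intro!: eventually_sequentiallyI[of 1]\<close>)
qed

text \<open>The new ray is the limit of geodesics from x to points \<open>z n\<close> that only have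
  to stay close to the old ray. The limit is part of the conclusion so that the points
  \<open>z n\<close> can be taken from a closed convex set or from an orbit.\<close>

lemma (in CAT0_space) asymptotic_ray_exists:
  assumes complete: "\<And>u :: nat \<Rightarrow> 'a. Cauchy u \<Longrightarrow> convergent u"
    and c: "geodesic_ray c" and z: "\<And>n. dist (z n) (c (real n)) \<le> B"
  obtains c' where "geodesic_ray c'" "c' 0 = (x::'a)" "asymptotic c c'"
    "\<And>t. t \<ge> 0 \<Longrightarrow> (\<lambda>n. geo x (z n) (t / real n)) \<longlonglongrightarrow> c' t"
proof -
  have B: "B \<ge> 0" using z[of 0] zero_le_dist[of "z 0" "c (real 0)"] by linarith
  define E where "E = dist x (c 0) + B"
  have near: "dist (geo x (z m) (t / real m)) (c t) \<le> E" if "0 \<le> t" "t \<le> real m" for t m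
  proof -
    have a: "t / real m \<in> {0..1}" using that by (auto simp: divide_le_eq_1)
    have "dist (geo x (z m) (t / real m)) (geo (c 0) (c (real m)) (t / real m))
        \<le> (1 - t / real m) * dist x (c 0) + t / real m * dist (z m) (c (real m))"
      by (rule dist_geo_convex[OF a])
    also have "\<dots> \<le> 1 * dist x (c 0) + 1 * B"
      by (intro add_mono mult_mono) (use a z B in auto)
    finally show ?thesis using geo_ray[OF c that] by (simp add: E_def)
  qed
  have cauchy_bound: "dist (geo x (z n) (t / real n)) (geo x (z m) (t / real m)) \<le> t / real n * (E + B)"
    if t: "0 \<le> t" "t \<le> real n" and n: "0 < n" "n \<le> m" for t n m
  proof -
    \<comment> \<open>The point of the longer geodesic matching \<open>z n\<close>: both are close
      to \<open>c n\<close>, and moving towards x scales their distance by t / n.\<close>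
    define w where "w = geo x (z m) (real n / real m)"
    have a: "t / real n \<in> {0..1}" "real n / real m \<in> {0..1}" using t n by (auto simp: divide_le_eq_1)
    have "geo x w (t / real n) = geo x (z m) (t / real m)"
      unfolding w_def using n by (simp add: geo_geo[OF a])
    then have "dist (geo x (z n) (t / real n)) (geo x (z m) (t / real m)) \<le> t / real n * dist (z n) w"
      using dist_geo_same_start[OF a(1), of x "z n" w] by simp
    also have "\<dots> \<le> t / real n * (E + B)"
    proof (rule mult_left_mono)
      show "dist (z n) w \<le> E + B"
        using near[of "real n" m] n z[of n] dist_triangle2[of "z n" w "c (real n)"] by (simp add: w_def)
    qed (use a in simp)
    finally show ?thesis .
  qed
  have conv: "convergent (\<lambda>n. geo x (z n) (t / real n))" if t: "t \<ge> 0" for t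
  proof (rule complete, rule CauchyI')
    fix e :: real assume e: "e > 0"
    \<comment> \<open>The first bound on N keeps the parameters t / n in [0, 1], the second makes
      the estimate smaller than e.\<close>
    obtain N where N: "real N > max t (t * (E + B) / e)" using reals_Archimedean2 by blast
    then have "N > 0" using t by (metis max.strict_boundedE of_nat_0_less_iff order_le_less_trans)
    show "\<exists>M. \<forall>m\<ge>M. \<forall>n>m. dist (geo x (z m) (t / real m)) (geo x (z n) (t / real n)) < e"
    proof (intro exI allI impI)
      fix m n assume mn: "N \<le> m" "m < n"
      have m: "real m \<ge> real N" "m > 0" using mn \<open>N > 0\<close> by auto
      have "t * (E + B) / e < real m" using N m by linarith
      then have "t / real m * (E + B) < e" using e m by (simp add: field_simps)
      then show "dist (geo x (z m) (t / real m)) (geo x (z n) (t / real n)) < e"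
        using cauchy_bound[OF t, of m n] N mn m by linarith
    qed
  qed
  define c' where "c' t = lim (\<lambda>n. geo x (z n) (t / real n))" for t
  have lim: "(\<lambda>n. geo x (z n) (t / real n)) \<longlonglongrightarrow> c' t" if "t \<ge> 0" for t
    using conv[OF that] unfolding c'_def by (simp add: convergent_LIMSEQ_iff)
  have ev: "eventually (\<lambda>n. t \<le> real n \<and> n > 0) sequentially" for t
    by (intro eventually_conj eventually_gt_at_top)
       (rule filterlim_at_top[THEN iffD1, OF filterlim_real_sequentially, rule_format])
  have "geodesic_ray c'"
    unfolding geodesic_ray_def
  proof (intro allI impI)
    fix s t :: real assume st: "s \<ge> 0" "t \<ge> 0"
    have "(\<lambda>n. \<bar>s - t\<bar> * (dist x (z n) / real n)) \<longlonglongrightarrow> \<bar>s - t\<bar> * 1"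
      by (intro tendsto_intros tendsto_dist_quotient[OF c z])
    moreover have "eventually (\<lambda>n. \<bar>s - t\<bar> * (dist x (z n) / real n)
        = dist (geo x (z n) (s / real n)) (geo x (z n) (t / real n))) sequentially"
      using ev[of s] ev[of t]
    proof eventually_elim
      case (elim n)
      then have "s / real n \<in> {0..1}" "t / real n \<in> {0..1}" using st by (auto simp: divide_le_eq_1)
      then have "dist (geo x (z n) (s / real n)) (geo x (z n) (t / real n))
          = \<bar>s / real n - t / real n\<bar> * dist x (z n)"
        by (rule dist_geo_geo)
      also have "s / real n - t / real n = (s - t) / real n" by (simp add: diff_divide_distrib)
      finally show ?case by simp
    qed
    ultimately have "(\<lambda>n. dist (geo x (z n) (s / real n)) (geo x (z n) (t / real n))) \<longlonglongrightarrow> \<bar>s - t\<bar>"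
      using Lim_transform_eventually by fastforce
    moreover have "(\<lambda>n. dist (geo x (z n) (s / real n)) (geo x (z n) (t / real n))) \<longlonglongrightarrow> dist (c' s) (c' t)"
      by (intro tendsto_dist lim st)
    ultimately show "dist (c' s) (c' t) = \<bar>s - t\<bar>" using LIMSEQ_unique by blast
  qed
  moreover have "c' 0 = x"
    using lim[of 0] LIMSEQ_unique[OF _ tendsto_const[of x]] by simp
  moreover have "dist (c t) (c' t) \<le> E" if t: "t \<ge> 0" for t
  proof (rule tendsto_upperbound)
    show "(\<lambda>n. dist (c t) (geo x (z n) (t / real n))) \<longlonglongrightarrow> dist (c t) (c' t)"
      by (intro tendsto_dist tendsto_const lim t)
    show "eventually (\<lambda>n. dist (c t) (geo x (z n) (t / real n)) \<le> E) sequentially"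
      using ev[of t] by eventually_elim (use near[OF t] in \<open>simp add: dist_commute\<close>)
  qed simp
  then have "asymptotic c c'" unfolding asymptotic_def by blast
  ultimately show thesis using lim by (rule that)
qed

text \<open>With a common origin, the distance at time t is at most t / n times the one at time n,
  which is bounded; let n tend to infinity.\<close>

lemma (in CAT0_space) asymptotic_rays_eq:
  assumes c: "geodesic_ray c" "geodesic_ray c'" and start: "c 0 = (c' 0 :: 'a)"
    and asym: "asymptotic c c'" and t: "t \<ge> 0"
  shows "c t = c' t"
proof -
  obtain B where B: "\<And>t. t \<ge> 0 \<Longrightarrow> dist (c t) (c' t) \<le> B"
    using asym unfolding asymptotic_def by blast
  have "dist (c t) (c' t) \<le> t * B / real n" if n: "n > 0" "real n \<ge> t" for n
  proof -
    have a: "t / real n \<in> {0..1}" using t n by (auto simp: divide_le_eq_1)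
    have "dist (c t) (c' t) \<le> t / real n * dist (c (real n)) (c' (real n))"
      using dist_geo_same_start[OF a, of "c 0" "c (real n)" "c' (real n)"]
        geo_ray[OF c(1) t n(2)] geo_ray[OF c(2) t n(2)] start by simp
    also have "\<dots> \<le> t / real n * B" using B[of "real n"] a by (intro mult_left_mono) auto
    finally show ?thesis by simp
  qed
  moreover have "n > 0 \<and> real n \<ge> t" if "n \<ge> Suc (nat \<lceil>t\<rceil>)" for n
    using that by linarith
  ultimately have "eventually (\<lambda>n. dist (c t) (c' t) \<le> t * B / real n) sequentially"
    by (intro eventually_sequentiallyI[of "Suc (nat \<lceil>t\<rceil>)"]) blast
  then have "dist (c t) (c' t) \<le> 0"
    by (rule tendsto_lowerbound[OF lim_const_over_n]) simp
  then show ?thesis by simp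
qed

section \<open>Boundary points as classes of asymptotic rays\<close>

lemma vis_boundary_ray: "\<xi> \<in> vis_boundary \<Longrightarrow> c \<in> \<xi> \<Longrightarrow> geodesic_ray c"
  by (auto simp: vis_boundary_def)

lemma vis_boundary_asymptotic:
  assumes "\<xi> \<in> vis_boundary" "c \<in> \<xi>" "c' \<in> \<xi>"
  shows "asymptotic c c'"
proof -
  obtain c0 where "asymptotic c0 c" "asymptotic c0 c'" using assms by (auto simp: vis_boundary_def)
  then obtain A B where "\<And>t. t \<ge> 0 \<Longrightarrow> dist (c0 t) (c t) \<le> A" "\<And>t. t \<ge> 0 \<Longrightarrow> dist (c0 t) (c' t) \<le> B"
    unfolding asymptotic_def by blast
  then have "dist (c t) (c' t) \<le> A + B" if "t \<ge> 0" for t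
    using that dist_triangle3[of "c t" "c' t" "c0 t"] by force
  then show ?thesis unfolding asymptotic_def by blast
qed

lemma vis_boundary_mem:
  assumes "\<xi> \<in> vis_boundary" "c \<in> \<xi>" "geodesic_ray c'" "asymptotic c c'"
  shows "c' \<in> \<xi>"
proof -
  obtain c0 where c0: "\<xi> = {c'. geodesic_ray c' \<and> asymptotic c0 c'}"
    using assms(1) by (auto simp: vis_boundary_def)
  then obtain A B where "\<And>t. t \<ge> 0 \<Longrightarrow> dist (c0 t) (c t) \<le> A" "\<And>t. t \<ge> 0 \<Longrightarrow> dist (c t) (c' t) \<le> B"
    using assms(2,4) unfolding asymptotic_def by blast
  then have "dist (c0 t) (c' t) \<le> A + B" if "t \<ge> 0" for t
    using that dist_triangle[of "c0 t" "c' t" "c t"] by force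
  then show ?thesis using c0 assms(3) unfolding asymptotic_def by blast
qed

section \<open>Special subgroups\<close>

text \<open>The map w sends the wall of the conjugated reflection onto the wall of r, so it maps a
  component of one complement into a component of the other.\<close>

lemma side_image:
  assumes w: "isometry w" and y: "y \<in> side (inv w \<circ> r \<circ> w) x"
  shows "w y \<in> side r (w x)"
proof -
  let ?A = "side (inv w \<circ> r \<circ> w) x"
  have "x \<in> ?A" using y connected_component_in[of _ x y] by (auto simp: side_def)
  then have "w x \<in> w ` ?A" by (rule imageI)
  moreover have "connected (w ` ?A)"
    by (rule connected_continuous_image[OF continuous_on_isometry[OF w]]) (simp add: side_def)
  moreover have "w ` ?A \<subseteq> - wall r"
  proof clarify
    fix z assume "z \<in> ?A" "w z \<in> wall r"
    then have "z \<in> wall (inv w \<circ> r \<circ> w)" using w by (simp add: wall_def)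
    then show False using side_not_wall[OF \<open>z \<in> ?A\<close>] by contradiction
  qed
  ultimately have "w ` ?A \<subseteq> side r (w x)" unfolding side_def[of r] by (rule connected_component_maximal)
  then show ?thesis using y by blast
qed

context reflection_chamber
begin

lemma gen_grp_subset_W:
  assumes "T \<subseteq> W"
  shows "gen_grp T \<subseteq> W"
proof
  fix w assume "w \<in> gen_grp T"
  then show "w \<in> W"
    by (induction rule: gen_grp.induct) (use assms W_id W_comp W_inv in blast)+
qed

text \<open>Removes the definite description: C contains p and lies in one component.\<close>

lemma half_space_eq_side:
  assumes r: "r \<in> refls W"
  shows "half_space r C = side r p"
  unfolding half_space_def
proof (rule the_equality)
  show "side r p \<in> components (- wall r) \<and> C \<subseteq> side r p"
    using p_not_wall[OF r] C_side[OF _ r] by (auto simp: side_def intro: componentsI)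
next
  fix A assume A: "A \<in> components (- wall r) \<and> C \<subseteq> A"
  then obtain x where x: "A = side r x" by (auto simp: side_def elim: componentsE)
  then show "A = side r p" using A p side_eq[of p r x] by blast
qed

text \<open>A translate of C is connected and avoids every wall, so one of its points decides the
  side.\<close>

lemma image_C_side:
  assumes w: "w \<in> W" and r: "r \<in> refls W" and x: "x \<in> C" "w x \<in> side r q"
  shows "w ` C \<subseteq> side r q"
proof (rule side_maximal)
  have "connected C" by (subst C_component) simp
  then show "connected (w ` C)"
    by (rule connected_continuous_image[OF continuous_on_isometry[OF W_isometry_group(2)[OF w]]])
  show "w ` C \<subseteq> - wall r"
    using not_walls_image[OF w C_not_walls] r by (auto simp: walls_def)
  show "w x \<in> w ` C" using x(1) by (rule imageI)
qed (rule x(2))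

text \<open>By minimality of \<open>S\<close>, a geodesic from \<open>p\<close> to a point that violates only the condition for
  \<open>s\<close> leaves \<open>C\<close> at a point \<open>q\<close> lying on \<open>wall s\<close> and on no other wall of \<open>S\<close>; near \<open>q\<close> there are
  only points of \<open>C\<close>, of \<open>s C\<close> and of \<open>wall s\<close>.\<close>
lemma minimal_gens_face:
  assumes S: "minimal_chamber_gens W C S" and s: "s \<in> S"
  obtains q where "q \<in> wall s" "\<And>s'. s' \<in> S \<Longrightarrow> s' \<noteq> s \<Longrightarrow> q \<in> side s' p"
    "\<And>e. e > 0 \<Longrightarrow> \<exists>c\<in>C. dist q c < e"
proof -
  have SR: "S \<subseteq> refls W" using S by (simp add: minimal_chamber_gens_def)
  then have sR: "s \<in> refls W" using s by blast
  have hs: "(\<Inter>s'\<in>S'. half_space s' C) = (\<Inter>s'\<in>S'. side s' p)" if "S' \<subseteq> S" for S'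
    using that SR by (intro INF_cong refl half_space_eq_side) blast
  have CS: "C = (\<Inter>s'\<in>S. side s' p)"
    using S hs[of S] unfolding minimal_chamber_gens_def by simp
  have "S - {s} \<subset> S" using s by blast
  then have "C \<noteq> (\<Inter>s'\<in>S - {s}. side s' p)"
    using S hs[of "S - {s}"] unfolding minimal_chamber_gens_def by (metis psubset_imp_subset)
  then obtain x where x: "\<And>s'. s' \<in> S \<Longrightarrow> s' \<noteq> s \<Longrightarrow> x \<in> side s' p" "x \<notin> C"
    using CS by blast
  then have xs: "x \<notin> side s p" using CS by blast
  \<comment> \<open>The least element of B is the first time the segment from p to x meets the wall
    of s; it exists because B is closed.\<close>
  define B where "B = {0..1} \<inter> geo p x -` wall s"
  have "closed B"
    unfolding B_def
    by (rule continuous_closed_preimage[OF continuous_on_geo _ closed_wall[OF refls_reflection[OF sR]]]) simp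
  moreover have "B \<noteq> {}" using geo_meets_wall[OF xs p_not_wall[OF sR]] by (auto simp: B_def)
  moreover have bdd: "bdd_below B" by (rule bdd_below_mono[of "{0..1}"]) (auto simp: B_def)
  ultimately have b0: "Inf B \<in> B" using closed_contains_Inf by blast
  define b where "b = Inf B"
  define q where "q = geo p x b"
  have b: "b \<in> {0..1}" "q \<in> wall s" using b0 by (auto simp: B_def b_def q_def)
  have first: "geo p x a \<in> C" if a: "0 \<le> a" "a < b" for a
  proof -
    have a01: "a \<in> {0..1}" using a b by auto
    have "geo p x a \<in> side s p"
    proof (rule ccontr)
      assume "geo p x a \<notin> side s p"
      then obtain t where t: "t \<in> {0..1}" "geo p (geo p x a) t \<in> wall s"
        using geo_meets_wall[OF _ p_not_wall[OF sR]] by blast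
      then have "geo p x (t * a) \<in> wall s" by (simp add: geo_geo[OF t(1) a01])
      moreover have "t * a \<le> a" "0 \<le> t * a" using t(1) a by (auto simp: mult_left_le_one_le)
      ultimately have "t * a \<in> B" using a01 by (auto simp: B_def)
      then have "b \<le> t * a" unfolding b_def by (rule cInf_lower[OF _ bdd])
      then show False using \<open>t * a \<le> a\<close> a by linarith
    qed
    moreover have "geo p x a \<in> side s' p" if "s' \<in> S" "s' \<noteq> s" for s'
    proof -
      have s': "s' \<in> refls W" using that SR by blast
      show ?thesis
        by (rule geo_convexD[OF reflection_sides(1)[OF refls_reflection[OF s'] p_not_wall[OF s']]
              side_self[OF p_not_wall[OF s']] x(1)[OF that] a01])
    qed
    ultimately show ?thesis unfolding CS by blast
  qed
  show thesis
  proof (rule that)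
    show "q \<in> wall s" by (rule b(2))
    show "q \<in> side s' p" if "s' \<in> S" "s' \<noteq> s" for s'
    proof -
      have s': "s' \<in> refls W" using that SR by blast
      show ?thesis unfolding q_def
        by (rule geo_convexD[OF reflection_sides(1)[OF refls_reflection[OF s'] p_not_wall[OF s']]
              side_self[OF p_not_wall[OF s']] x(1)[OF that] b(1)])
    qed
    show "\<exists>c\<in>C. dist q c < e" if e: "e > 0" for e
    proof -
      have "b \<noteq> 0" using b(2) p_not_wall[OF sR] by (auto simp: q_def)
      then have "b > 0" using b(1) by simp
      \<comment> \<open>Going back by h along the segment moves q by less than e; the added 1 keeps
        the denominator positive.\<close>
      define h where "h = min b (e / (dist p x + 1))"
      have D: "dist p x + 1 > 0" by (rule add_nonneg_pos) simp_all
      have h: "0 < h" "h \<le> b" using \<open>b > 0\<close> e D by (simp_all add: h_def)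
      have "b - h \<in> {0..1}" using h b(1) by auto
      then have "dist q (geo p x (b - h)) = h * dist p x"
        unfolding q_def using dist_geo_geo[OF b(1), of "b - h" p x] h by simp
      also have "\<dots> < h * (dist p x + 1)" using h(1) by simp
      also have "\<dots> \<le> e / (dist p x + 1) * (dist p x + 1)"
        by (rule mult_right_mono) (use D in \<open>simp_all add: h_def\<close>)
      also have "\<dots> = e" using D by simp
      finally show ?thesis using first[of "b - h"] h by (intro bexI[of _ "geo p x (b - h)"]) simp_all
    qed
  qed
qed

text \<open>Around the face point q of s, the side of s containing p consists of points of C only.
  The wall of r passes through q, so for c in C near q also r c is near q. It is not in C, hence
  lies beyond the wall of s, and s r c is back in C. Simple transitivity on chambers forces s r =
  id.\<close>

lemma minimal_gens_wall_unique:
  assumes S: "minimal_chamber_gens W C S" and s: "s \<in> S"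
    and r: "r \<in> refls W" and sep: "s p \<notin> side r p"
  shows "r = s"
proof -
  have SR: "S \<subseteq> refls W" using S by (simp add: minimal_chamber_gens_def)
  then have sR: "s \<in> refls W" using s by blast
  have "(\<Inter>s'\<in>S. half_space s' C) = (\<Inter>s'\<in>S. side s' p)"
    using SR by (intro INF_cong refl half_space_eq_side) blast
  then have CS: "C = (\<Inter>s'\<in>S. side s' p)"
    using S unfolding minimal_chamber_gens_def by simp
  note rW = refls_W[OF r] and sW = refls_W[OF sR]
  note rr = refls_reflection[OF r] and sr = refls_reflection[OF sR]
  obtain q where q: "q \<in> wall s" "\<And>s'. s' \<in> S \<Longrightarrow> s' \<noteq> s \<Longrightarrow> q \<in> side s' p"
    "\<And>e. e > 0 \<Longrightarrow> \<exists>c\<in>C. dist q c < e"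
    using minimal_gens_face[OF S s] by blast
  have dist_s: "dist q (s x) = dist q x" for x
    using isometry_dist[OF reflection_isometry[OF sr], of q x] q(1) by (simp add: wall_def)
  have sC: "s c \<notin> side r p" if "c \<in> C" for c
    using image_C_side[OF sW r that] sep p by blast
  \<comment> \<open>Otherwise a ball about q lies on one side of r, although it contains points c of
    C and s c of s C, which r separates.\<close>
  have "q \<in> wall r"
  proof (rule ccontr)
    assume "q \<notin> wall r"
    then have "q \<in> side r q" by (rule side_self)
    then obtain d where d: "d > 0" "ball q d \<subseteq> side r q"
      using open_side[OF rr] open_contains_ball by blast
    obtain c where c: "c \<in> C" "dist q c < d" using q(3)[OF d(1)] by blast
    have "c \<in> side r q" "s c \<in> side r q" using c(2) d(2) dist_s[of c] by auto
    then have "s c \<in> side r p"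
      using side_eq[of c r q] side_eq[OF C_side[OF c(1) r]] by simp
    then show False using sC[OF c(1)] by contradiction
  qed
  then have dist_r: "dist q (r x) = dist q x" for x
    using isometry_dist[OF reflection_isometry[OF rr], of q x] by (simp add: wall_def)
  obtain e where e: "e > 0" "\<forall>r\<in>refls W. wall r \<inter> ball q e \<noteq> {} \<longrightarrow> q \<in> wall r"
    using locally_finite_walls by blast
  have near: "x \<in> C" if "dist q x < e" "x \<in> side s p" for x
  proof -
    have "x \<in> side s' p" if s': "s' \<in> S" for s'
    proof (cases "s' = s")
      case False
      have "s' \<in> refls W" using s' SR by blast
      then have "ball q e \<subseteq> side s' p" by (rule ball_side[OF e(2,1) _ q(2)[OF s' False]])
      then show ?thesis using \<open>dist q x < e\<close> by auto
    qed (use \<open>x \<in> side s p\<close> in simp)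
    then show ?thesis unfolding CS by blast
  qed
  obtain c where c: "c \<in> C" "dist q c < e" using q(3)[OF e(1)] by blast
  have "r c \<notin> C"
    using reflection_leaves_side[OF rr C_side[OF c(1) r]] C_side[OF _ r] by metis
  then have "r c \<notin> side s p" using near[of "r c"] c(2) dist_r[of c] by auto
  moreover have "r c \<notin> wall s"
    using not_walls_image[OF rW C_not_walls[OF c(1)]] sR unfolding walls_def by blast
  ultimately have "r c \<notin> closed_side s p" by (simp add: closed_side_def)
  then have "s (r c) \<in> side s p" by (rule reflection_enters_side[OF sr p_not_wall[OF sR]])
  then have "s (r c) \<in> C" using near[of "s (r c)"] c(2) dist_r[of c] dist_s[of "r c"] by simp
  then have "s \<circ> r = id" using chamber_image_eq[OF W_comp[OF sW rW] c(1)] by simp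
  then have "s (r x) = x" for x by (metis comp_apply id_apply)
  then have "r x = s x" for x by (metis reflection_reflection[OF sr])
  then show "r = s" by (rule ext)
qed

text \<open>Induction on words in T. For a generator g, the conjugate of r by g is again outside the
  subgroup, so the induction hypothesis holds for it; applying g puts g x on the side of g p. Since
  r differs from g, wall uniqueness puts g p on the side of p.\<close>

lemma special_subgroup_side:
  assumes S: "minimal_chamber_gens W C S" and T: "T \<subseteq> S"
    and w: "w \<in> gen_grp T" and r: "r \<in> refls W" "r \<notin> gen_grp T"
  shows "w p \<in> side r p"
proof -
  have SR: "T \<subseteq> refls W" using T S by (auto simp: minimal_chamber_gens_def)
  have inv_T: "inv g = g" if "g \<in> T" for g
    using that SR reflection_inv refls_reflection by blast
  have step: "g x \<in> side r p"
    if g: "g \<in> T" and x: "\<And>r. r \<in> refls W \<Longrightarrow> r \<notin> gen_grp T \<Longrightarrow> x \<in> side r p"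
      and r: "r \<in> refls W" "r \<notin> gen_grp T" for g x r
  proof -
    have gR: "g \<in> refls W" using g SR by blast
    note gr = refls_reflection[OF gR] and gT = gen_grp_base[OF g]
    let ?r = "inv g \<circ> r \<circ> g"
    have "?r \<in> refls W" using refls_conj[OF refls_W[OF gR] r(1)] unfolding inv_T[OF g] .
    moreover have "?r \<notin> gen_grp T"
    proof
      assume "?r \<in> gen_grp T"
      then have "g \<circ> (?r \<circ> g) \<in> gen_grp T" by (rule gen_grp_comp[OF gT gen_grp_comp[OF _ gT]])
      moreover have "g \<circ> (?r \<circ> g) = r"
        by (rule ext) (simp add: inv_T[OF g] reflection_reflection[OF gr])
      ultimately show False using r(2) by metis
    qed
    ultimately have "x \<in> side ?r p" by (rule x)
    then have "g x \<in> side r (g p)" by (rule side_image[OF reflection_isometry[OF gr]])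
    moreover have "g p \<in> side r p"
      using minimal_gens_wall_unique[OF S _ r(1)] g T r(2) gT by blast
    ultimately show ?thesis using side_eq[of "g p" r p] by simp
  qed
  show ?thesis
    using w r
  proof (induction arbitrary: r rule: gen_grp.induct)
    case gen_id
    then show ?case by (simp add: side_self p_not_wall)
  next
    case (gen_mul g w)
    then show ?case using step[of g "w p" r] by simp
  next
    case (gen_inv g w)
    then show ?case using step[of g "w p" r] inv_T[of g] by simp
  qed
qed

text \<open>For the inclusion from right to left, conjugation by the subgroup preserves the
  reflections outside it. So the conditions on y pass to its whole orbit under the subgroup, as
  \<open>orbit_of_closure_C\<close> demands.\<close>

lemma special_subgroup_orbit:
  assumes S: "minimal_chamber_gens W C S" and T: "T \<subseteq> S"
  shows "(\<Union>w\<in>gen_grp T. w ` closure C) = (\<Inter>r\<in>refls W - gen_grp T. closed_side r p)"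
proof -
  let ?V = "gen_grp T"
  have TR: "T \<subseteq> refls W" using S T by (auto simp: minimal_chamber_gens_def)
  have T_iso: "isometry g" if "g \<in> T" for g
    using that TR reflection_isometry refls_reflection by blast
  have V: "fun_group ?V" by (rule fun_group_gen_grp) (rule T_iso)
  have VW: "?V \<subseteq> W" by (rule gen_grp_subset_W) (use TR refls_W in blast)
  show ?thesis
  proof (intro equalityI subsetI)
    fix y assume "y \<in> (\<Union>w\<in>?V. w ` closure C)"
    then obtain w x where w: "w \<in> ?V" and x: "x \<in> closure C" "y = w x" by blast
    have wW: "w \<in> W" using w VW by blast
    have "y \<in> closed_side r p" if r: "r \<in> refls W" "r \<notin> ?V" for r
    proof -
      have "w ` C \<subseteq> closed_side r p"
        using image_C_side[OF wW r(1) p special_subgroup_side[OF S T w r]] by (auto simp: closed_side_def)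
      moreover have "w ` closure C \<subseteq> closure (w ` C)"
        
        by (rule image_closure_subset[OF continuous_on_isometry[OF W_isometry_group(2)[OF wW]] closed_closure closure_subset])
      ultimately have "w ` closure C \<subseteq> closed_side r p"
        using closure_minimal[OF _ closed_closed_side[OF refls_reflection[OF r(1)] p_not_wall[OF r(1)]]] by blast
      then show ?thesis using x by blast
    qed
    then show "y \<in> (\<Inter>r\<in>refls W - ?V. closed_side r p)" by blast
  next
    fix y assume y: "y \<in> (\<Inter>r\<in>refls W - ?V. closed_side r p)"
    show "y \<in> (\<Union>w\<in>?V. w ` closure C)"
    proof (rule orbit_of_closure_C[OF V VW])
      fix w r assume w: "w \<in> ?V" and r: "r \<in> refls W" "r \<notin> ?V"
      have wW: "w \<in> W" using w VW by blast
      note iso = W_isometry_group(2)[OF wW]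
      let ?r = "inv w \<circ> r \<circ> w"
      have inv_V: "inv w \<in> ?V" using V w by (simp add: fun_group_def)
      have "?r \<in> refls W"
        using refls_conj[OF W_inv[OF wW] r(1)] unfolding inv_inv_eq[OF isometry_bij[OF iso]] .
      moreover have "?r \<notin> ?V"
      proof
        assume "?r \<in> ?V"
        then have "w \<circ> (?r \<circ> inv w) \<in> ?V" by (rule gen_grp_comp[OF w gen_grp_comp[OF _ inv_V]])
        moreover have "w \<circ> (?r \<circ> inv w) = r" by (rule ext) (simp add: iso)
        ultimately show False using r(2) by metis
      qed
      ultimately have "y \<in> closed_side ?r p" using y by blast
      then consider "y \<in> side ?r p" | "y \<in> wall ?r" unfolding closed_side_def by blast
      then show "w y \<in> closed_side r p"
      proof cases
        case 1
        then have "w y \<in> side r (w p)" by (rule side_image[OF iso])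
        then show ?thesis
          using side_eq[OF special_subgroup_side[OF S T w r]] by (simp add: closed_side_def)
      next
        case 2
        then have "inv w (r (w y)) = y" by (simp add: wall_def)
        then have "r (w y) = w y" using isometry_f_inv[OF iso, of "r (w y)"] by simp
        then show ?thesis by (simp add: closed_side_def wall_def)
      qed
    qed
  qed
qed

lemma geo_convex_Inter_closed_sides:
  assumes "R \<subseteq> refls W"
  shows "geo_convex (\<Inter>r\<in>R. closed_side r p)" "closed (\<Inter>r\<in>R. closed_side r p)"
proof -
  have r: "reflection r" "p \<notin> wall r" if "r \<in> R" for r
    using that assms refls_reflection p_not_wall by blast+
  show "closed (\<Inter>r\<in>R. closed_side r p)" by (intro closed_INT ballI closed_closed_side r)
  show "geo_convex (\<Inter>r\<in>R. closed_side r p)"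
    by (rule geo_convexI) (blast intro: geo_convexD[OF geo_convex_closed_side[OF r]])
qed

lemma bounded_closure_C: "\<exists>M. \<forall>x\<in>closure C. dist p x \<le> M"
  using compact_imp_bounded[OF compact_closure_C] bounded_any_center[of "closure C" p] by blast

text \<open>A bounded sequence stays in finitely many translates of the closed chamber: properness
  limits the elements w with w p in a given ball. Their union is compact, hence complete.\<close>

lemma Cauchy_imp_convergent:
  assumes u: "Cauchy (u :: nat \<Rightarrow> 'a)"
  shows "convergent u"
proof -
  obtain M where M: "\<And>x. x \<in> closure C \<Longrightarrow> dist p x \<le> M" using bounded_closure_C by blast
  obtain N where N: "\<And>n. dist p (u n) \<le> N"
    using cauchy_imp_bounded[OF u] bounded_any_center[of "range u" p] by blast
  define F where "F = {w\<in>W. dist p (w p) < N + M + 1}"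
  have "compact (\<Union>w\<in>F. w ` closure C)"
  proof (rule compact_UN)
    show "finite F" unfolding F_def by (rule finite_close)
    show "compact (w ` closure C)" if "w \<in> F" for w
      by (rule compact_continuous_image[OF continuous_on_isometry compact_closure_C])
         (use that in \<open>simp add: F_def W_isometry_group(2)\<close>)
  qed
  then have "complete (\<Union>w\<in>F. w ` closure C)" by (rule compact_imp_complete)
  moreover have "u n \<in> (\<Union>w\<in>F. w ` closure C)" for n
  proof -
    obtain w x where w: "w \<in> W" "x \<in> closure C" "u n = w x" using W_cover by blast
    have "dist (w x) (w p) \<le> M"
      using isometry_dist[OF W_isometry_group(2)[OF w(1)], of x p] M[OF w(2)] by (simp add: dist_commute)
    then have "dist p (w p) < N + M + 1"
      using N[of n] dist_triangle[of p "w p" "w x"] unfolding w(3) by linarith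
    then show ?thesis using w by (auto simp: F_def)
  qed
  ultimately show ?thesis using u unfolding complete_def convergent_def by blast
qed

end

section \<open>Limit sets\<close>

context reflection_chamber
begin

section \<open>Limit sets when the translates of the closed chamber form a closed convex set\<close>

context
  fixes V :: "('a \<Rightarrow> 'a) set" and Y :: "'a set"
  assumes VW: "V \<subseteq> W" and id_V: "id \<in> V" and Y_def: "Y = (\<Union>w\<in>V. w ` closure C)"
    and Y: "geo_convex Y" "closed Y"
begin

lemma p_orbit_mem: "g \<in> V \<Longrightarrow> g p \<in> Y"
  using closure_subset[of C] p unfolding Y_def by blast

text \<open>Geodesics from p to orbit points of p stay in Y and follow those from x0 at distance at
  most \<open>dist p x0\<close>. They supply points of Y near the given ray, and the asymptotic ray
  from p built from these stays in the closed set Y. The origin p is what convex-cocompactness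
  needs.\<close>

lemma limit_set_ray:
  assumes \<xi>: "\<xi> \<in> limit_set V x0"
  shows "\<exists>c\<in>\<xi>. c 0 = p \<and> (\<forall>t\<ge>0. c t \<in> Y)"
proof -
  obtain c where \<xi>b: "\<xi> \<in> vis_boundary" and c: "c \<in> \<xi>" "c 0 = x0"
    and ap: "\<And>r \<epsilon>. r > 0 \<Longrightarrow> \<epsilon> > 0 \<Longrightarrow> \<exists>g\<in>V. dist x0 (g x0) > r \<and>
        (\<exists>\<sigma>. geodesic_seg \<sigma> x0 (g x0) \<and> dist (\<sigma> r) (c r) < \<epsilon>)"
    using \<xi> unfolding limit_set_def by blast
  have ray: "geodesic_ray c" by (rule vis_boundary_ray[OF \<xi>b c(1)])
  have "\<exists>z\<in>Y. dist z (c (real n)) \<le> dist p x0 + 1" for n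
  \<comment> \<open>Neighbourhoods in the limit set have positive radius, so n = 0 needs its own
    witness.\<close>
  proof (cases "n = 0")
    case True
    then show ?thesis using c(2) p_orbit_mem[OF id_V] by (intro bexI[of _ p]) simp_all
  next
    case False
    then obtain g \<sigma> where g: "g \<in> V" "dist x0 (g x0) > real n"
      and \<sigma>: "geodesic_seg \<sigma> x0 (g x0)" "dist (\<sigma> (real n)) (c (real n)) < 1"
      using ap[of "real n" 1] by auto
    define a where "a = real n / dist x0 (g x0)"
    have a: "a \<in> {0..1}" using g(2) by (auto simp: a_def divide_le_eq_1)
    have \<sigma>n: "\<sigma> (real n) = geo x0 (g x0) a"
      unfolding a_def using g(2) by (intro geodesic_seg_eq_geo[OF \<sigma>(1)]) simp
    have gi: "dist (g p) (g x0) = dist p x0"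
      using isometry_dist[OF W_isometry_group(2)] g(1) VW by blast
    have "dist (geo p (g p) a) (\<sigma> (real n)) \<le> (1 - a) * dist p x0 + a * dist (g p) (g x0)"
      unfolding \<sigma>n by (rule dist_geo_convex[OF a])
    also have "\<dots> = dist p x0" unfolding gi by (simp add: algebra_simps)
    finally have "dist (geo p (g p) a) (c (real n)) \<le> dist p x0 + 1"
      using \<sigma>(2) dist_triangle[of "geo p (g p) a" "c (real n)" "\<sigma> (real n)"] by linarith
    moreover have "geo p (g p) a \<in> Y"
      using geo_convexD[OF Y(1) p_orbit_mem[OF id_V] p_orbit_mem[OF g(1)] a] by simp
    ultimately show ?thesis by blast
  qed
  then obtain z where z: "\<And>n. z n \<in> Y" "\<And>n. dist (z n) (c (real n)) \<le> dist p x0 + 1" by metis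
  obtain c' where c': "geodesic_ray c'" "c' 0 = p" "asymptotic c c'"
    "\<And>t. t \<ge> 0 \<Longrightarrow> (\<lambda>n. geo p (z n) (t / real n)) \<longlonglongrightarrow> c' t"
    using asymptotic_ray_exists[OF Cauchy_imp_convergent ray z(2), of p] by blast
  have "c' t \<in> Y" if t: "t \<ge> 0" for t
  proof (rule Lim_in_closed_set[OF Y(2) _ _ c'(4)[OF t]])
    have "geo p (z n) (t / real n) \<in> Y" if n: "n \<ge> Suc (nat \<lceil>t\<rceil>)" for n
    proof -
      have "t \<le> real n" using n by linarith
      then have "t / real n \<in> {0..1}" using t by (auto simp: divide_le_eq_1)
      then show ?thesis
        using geo_convexD[OF Y(1) p_orbit_mem[OF id_V] z(1)] by simp
    qed
    then show "eventually (\<lambda>n. geo p (z n) (t / real n) \<in> Y) sequentially"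
      by (rule eventually_sequentiallyI)
  qed simp
  moreover have "c' \<in> \<xi>" by (rule vis_boundary_mem[OF \<xi>b c(1) c'(1,3)])
  ultimately show ?thesis using c'(2) by blast
qed

text \<open>For the second inclusion, a ray in Y stays at bounded distance from orbit points of x0,
  because the closed chamber is bounded. The geodesics from x0 to these points converge to the
  asymptotic ray from x0, which yields the required neighbourhoods.\<close>

lemma limit_set_eq_boundary: "limit_set V x0 = boundary_of Y"
proof (intro equalityI subsetI)
  fix \<xi> assume "\<xi> \<in> limit_set V x0"
  then show "\<xi> \<in> boundary_of Y"
    using limit_set_ray[of \<xi> x0] by (auto simp: boundary_of_def limit_set_def)
next
  fix \<xi> assume "\<xi> \<in> boundary_of Y"
  then obtain c where \<xi>: "\<xi> \<in> vis_boundary" and c: "c \<in> \<xi>" "\<And>t. t \<ge> 0 \<Longrightarrow> c t \<in> Y"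
    unfolding boundary_of_def by blast
  have ray: "geodesic_ray c" by (rule vis_boundary_ray[OF \<xi> c(1)])
  obtain M where M: "\<And>x. x \<in> closure C \<Longrightarrow> dist p x \<le> M" using bounded_closure_C by blast
  have "\<exists>g\<in>V. dist (g x0) (c (real n)) \<le> dist p x0 + M" for n
  proof -
    obtain g x where g: "g \<in> V" and x: "x \<in> closure C" "c (real n) = g x"
      using c(2)[of "real n"] unfolding Y_def by auto
    have "dist (g x0) (g x) = dist x0 x"
      using isometry_dist[OF W_isometry_group(2)] g VW by blast
    also have "\<dots> \<le> dist p x0 + M"
      using M[OF x(1)] dist_triangle3[of x0 x p] by linarith
    finally show ?thesis using g x(2) by auto
  qed
  then obtain g where g: "\<And>n. g n \<in> V" "\<And>n. dist (g n x0) (c (real n)) \<le> dist p x0 + M" by metis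
  obtain c' where c': "geodesic_ray c'" "c' 0 = x0" "asymptotic c c'"
    "\<And>t. t \<ge> 0 \<Longrightarrow> (\<lambda>n. geo x0 (g n x0) (t / real n)) \<longlonglongrightarrow> c' t"
    using asymptotic_ray_exists[OF Cauchy_imp_convergent ray g(2), of x0] by blast
  have c'\<xi>: "c' \<in> \<xi>" by (rule vis_boundary_mem[OF \<xi> c(1) c'(1,3)])
  define l where "l n = dist x0 (g n x0)" for n
  have quot: "(\<lambda>n. l n / real n) \<longlonglongrightarrow> 1"
    unfolding l_def by (rule tendsto_dist_quotient[OF ray g(2)])
  have "\<exists>g\<in>V. dist x0 (g x0) > r \<and> (\<exists>\<sigma>. geodesic_seg \<sigma> x0 (g x0) \<and> dist (\<sigma> r) (c' r) < \<epsilon>)"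
    if r: "r > 0" and \<epsilon>: "\<epsilon> > 0" for r \<epsilon>
  proof -
    \<comment> \<open>The first summand is the distance between the points at arc length r and at
      parameter r / n on the n-th geodesic; the second is the distance from the latter to
      \<open>c' r\<close>.\<close>
    have "(\<lambda>n. \<bar>r - r * (l n / real n)\<bar> + dist (geo x0 (g n x0) (r / real n)) (c' r))
        \<longlonglongrightarrow> \<bar>r - r * 1\<bar> + dist (c' r) (c' r)"
      by (intro tendsto_intros quot c'(4)) (use r in simp)
    then have "eventually (\<lambda>n. \<bar>r - r * (l n / real n)\<bar>
        + dist (geo x0 (g n x0) (r / real n)) (c' r) < \<epsilon>) sequentially"
      using \<epsilon> by (intro order_tendstoD(2)) simp_all
    moreover have "eventually (\<lambda>n. l n / real n > 1 / 2) sequentially"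
      by (rule order_tendstoD(1)[OF quot]) simp
    \<comment> \<open>Together with the quotient above 1/2 this makes the orbit point farther than r
      from x0.\<close>
    moreover have "eventually (\<lambda>n. real n > 2 * r) sequentially"
      using filterlim_real_sequentially by (simp add: filterlim_at_top_dense)
    ultimately have "eventually (\<lambda>n. \<bar>r - r * (l n / real n)\<bar>
        + dist (geo x0 (g n x0) (r / real n)) (c' r) < \<epsilon> \<and> l n / real n > 1 / 2 \<and> real n > 2 * r) sequentially"
      by eventually_elim blast
    then obtain n where n: "\<bar>r - r * (l n / real n)\<bar> + dist (geo x0 (g n x0) (r / real n)) (c' r) < \<epsilon>"
      "l n / real n > 1 / 2" "real n > 2 * r"
      by (metis (mono_tags, lifting) eventually_sequentially order_refl)
    have n0: "real n > 0" using n(3) r by linarith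
    have "l n > real n / 2" using n(2) n0 by (simp add: field_simps)
    then have ln: "l n > r" using n(3) by linarith
    obtain \<sigma> where \<sigma>: "geodesic_seg \<sigma> x0 (g n x0)" "\<And>a. geo x0 (g n x0) a = \<sigma> (a * dist x0 (g n x0))"
      using geodesic_seg_geo by blast
    have \<sigma>r: "\<sigma> r = geo x0 (g n x0) (r / l n)"
      using ln r by (simp add: \<sigma>(2) l_def[symmetric])
    have "r / l n \<in> {0..1}" "r / real n \<in> {0..1}"
      using ln n(3) n0 r by (auto simp: divide_le_eq_1)
    then have "dist (\<sigma> r) (geo x0 (g n x0) (r / real n)) = \<bar>r / l n - r / real n\<bar> * l n"
      unfolding \<sigma>r l_def by (rule dist_geo_geo)
    also have "\<dots> = \<bar>(r / l n - r / real n) * l n\<bar>"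
      using ln r by (simp add: abs_mult)
    also have "(r / l n - r / real n) * l n = r - r * (l n / real n)"
      using ln r by (simp add: left_diff_distrib)
    finally have "dist (\<sigma> r) (c' r) < \<epsilon>"
      using n(1) dist_triangle[of "\<sigma> r" "c' r" "geo x0 (g n x0) (r / real n)"] by linarith
    then show ?thesis using g(1) ln \<sigma>(1) unfolding l_def by blast
  qed
  then show "\<xi> \<in> limit_set V x0"
    unfolding limit_set_def using \<xi> c'\<xi> c'(2) by blast
qed

text \<open>The closed chamber serves as compact set and p as base point. A ray from p to a limit
  point is unique, so it is the one that \<open>limit_set_ray\<close> places in Y.\<close>

lemma convex_cocompact_orbit: "convex_cocompact V"
  unfolding convex_cocompact_def
proof (intro exI[of _ "closure C"] conjI exI[of _ p] subsetI)
  fix x assume "x \<in> ray_union p (limit_set V p)"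
  then obtain c \<xi> t where c: "geodesic_ray c" "c 0 = p" "\<xi> \<in> limit_set V p" "c \<in> \<xi>"
    and t: "t \<ge> 0" "x = c t"
    unfolding ray_union_def by auto
  obtain c' where c': "c' \<in> \<xi>" "c' 0 = p" "\<And>t. t \<ge> 0 \<Longrightarrow> c' t \<in> Y"
    using limit_set_ray[OF c(3)] by blast
  have \<xi>: "\<xi> \<in> vis_boundary" using c(3) by (simp add: limit_set_def)
  have "c t = c' t"
    by (rule asymptotic_rays_eq[OF c(1) vis_boundary_ray[OF \<xi> c'(1)] _
          vis_boundary_asymptotic[OF \<xi> c(4) c'(1)] t(1)]) (simp add: c(2) c'(2))
  then show "x \<in> (\<Union>g\<in>V. g ` closure C)" using c'(3)[OF t(1)] t(2) unfolding Y_def by simp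
qed (rule compact_closure_C)

end

end

theorem theorem2p4:
  fixes W :: "('a::metric_space \<Rightarrow> 'a) set" and C :: "'a set"
    and S T :: "('a \<Rightarrow> 'a) set"
  assumes "CAT0 TYPE('a)"
    and "cocompact_discrete_refl_group W"
    and "chamber W C"
    and "minimal_chamber_gens W C S"
    and "T \<subseteq> S"
  shows "geo_convex (\<Union>w\<in>gen_grp T. w ` closure C)
    \<and> (\<forall>x0. limit_set (gen_grp T) x0 = boundary_of (\<Union>w\<in>gen_grp T. w ` closure C))
    \<and> convex_cocompact (gen_grp T)"
proof -
  have "C \<noteq> {}" using assms(3) by (auto simp: chamber_def dest: in_components_nonempty)
  then obtain p where "p \<in> C" by blast
  then interpret reflection_chamber "TYPE('a)" W C p
    using assms by unfold_locales
  let ?Y = "\<Union>w\<in>gen_grp T. w ` closure C"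
  \<comment> \<open>The description by closed half-spaces gives convexity and also closedness, which
    the limit arguments use.\<close>
  have Y: "geo_convex ?Y" "closed ?Y"
    unfolding special_subgroup_orbit[OF assms(4,5)] by (rule geo_convex_Inter_closed_sides, blast)+
  have "T \<subseteq> W" using assms(4,5) refls_W by (auto simp: minimal_chamber_gens_def)
  then have VW: "gen_grp T \<subseteq> W" by (rule gen_grp_subset_W)
  show ?thesis
    using Y(1) limit_set_eq_boundary[OF VW gen_id refl Y] convex_cocompact_orbit[OF VW gen_id refl Y]
    by blast
qed

end
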